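(* Let $\mathcal{E}=\{\epsilon_p(i),\ i\in[p],\ p\in\mathbb{N}\}$ be a uniformly decreasingly dependent (UDD) Gaussian triangular array with standard Normal marginals, and let $N_{\mathcal{E}}(\tau)<\infty$, $\tau>0$, be the associated bounds in the definition of UDD. Let $\tau(p)>0$ be a sequence with $\tau(p)\to 0$ such that $$\alpha(p):=\frac{\log N_{\mathcal{E}}(\tau(p))}{\log(p)}\to 0,\quad\text{as } p\to\infty.$$ Then, for every sequence $\delta_p>0$ such that $$\delta_p\gg \alpha(p)+\tau(p)+\frac{1}{\log(p)},$$ we have $$\mathbb{P}\left(\left|\frac{\max_{i\in[p]}\epsilon_p(i)}{u_p}-1\right|>\delta_p\right)\to 0,\quad\text{as } p\to\infty,$$ where $u_p=\Phi^{-1}(1-1/p)$ and $\Phi$ is the standard Normal cumulative distribution function.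
   Context: $[p]=\{1,\dots,p\}$. A Gaussian triangular array with standard Normal marginals is a family $\mathcal{E}=\{\epsilon_p(i),\ i\in[p],\ p\in\mathbb{N}\}$ such that, for each $p$, $(\epsilon_p(1),\dots,\epsilon_p(p))$ is a jointly Gaussian vector (with arbitrary dependence) and each $\epsilon_p(i)\sim N(0,1)$. UDD (uniformly decreasing dependence): $\mathcal{E}$ is UDD if for every $\tau>0$ there exists a finite $N_{\mathcal{E}}(\tau)<\infty$ such that for every $p\in\mathbb{N}$ and every $i\in\{1,\dots,p\}$, $$\bigl|\{k\in\{1,\dots,p\}:\ \mathrm{Cov}(\epsilon_p(k),\epsilon_p(i))>\tau\}\bigr|\le N_{\mathcal{E}}(\tau).$$ For two positive sequences $\alpha_p,\beta_p$ converging to $0$, $\alpha_p\gg\beta_p$ means $\beta_p/\alpha_p\to 0$ as $p\to\infty$ (so, in particular, $\delta_p\to0$). *)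

theory Defs
  imports "HOL-Probability.Probability"
begin

text \<open>The law N(m, s^2); for s = 0 it degenerates to the point mass at m.\<close>

definition normal_law :: "real \<Rightarrow> real \<Rightarrow> real measure" where
  "normal_law m s = (if s = 0 then return borel m else density lborel (normal_density m s))"

definition gaussian_rv :: "'a measure \<Rightarrow> ('a \<Rightarrow> real) \<Rightarrow> bool" where
  "gaussian_rv M X \<longleftrightarrow>
     X \<in> borel_measurable M \<and> (\<exists>m s. 0 \<le> s \<and> distr M borel X = normal_law m s)"

text \<open>Joint Gaussianity: every linear combination is univariate Gaussian. Since degenerate
  laws are allowed, the covariance matrix may be singular.\<close>

definition jointly_gaussian :: "'a measure \<Rightarrow> 'i set \<Rightarrow> ('i \<Rightarrow> 'a \<Rightarrow> real) \<Rightarrow> bool" where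
  "jointly_gaussian M I X \<longleftrightarrow>
     (\<forall>i\<in>I. X i \<in> borel_measurable M) \<and>
     (\<forall>a :: 'i \<Rightarrow> real. gaussian_rv M (\<lambda>\<omega>. \<Sum>i\<in>I. a i * X i \<omega>))"

definition covariance :: "'a measure \<Rightarrow> ('a \<Rightarrow> real) \<Rightarrow> ('a \<Rightarrow> real) \<Rightarrow> real" where
  "covariance M X Y =
     (\<integral>\<omega>. (X \<omega> - (\<integral>\<omega>'. X \<omega>' \<partial>M)) * (Y \<omega> - (\<integral>\<omega>'. Y \<omega>' \<partial>M)) \<partial>M)"

text \<open>In a triangular array \<open>\<epsilon>\<close>, only the entries \<open>\<epsilon> p i\<close> with \<open>p \<ge> 1\<close> and \<open>1 \<le> i \<le> p\<close> matter.\<close>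

definition gaussian_array :: "'a measure \<Rightarrow> (nat \<Rightarrow> nat \<Rightarrow> 'a \<Rightarrow> real) \<Rightarrow> bool" where
  "gaussian_array M \<epsilon> \<longleftrightarrow>
     (\<forall>p\<ge>1. jointly_gaussian M {1..p} (\<epsilon> p) \<and>
        (\<forall>i\<in>{1..p}. distr M borel (\<epsilon> p i) = std_normal_distribution))"

definition UDD_bound ::
    "'a measure \<Rightarrow> (nat \<Rightarrow> nat \<Rightarrow> 'a \<Rightarrow> real) \<Rightarrow> (real \<Rightarrow> real) \<Rightarrow> bool" where
  "UDD_bound M \<epsilon> N \<longleftrightarrow>
     (\<forall>\<tau>>0. \<forall>p\<ge>1. \<forall>i\<in>{1..p}.
        real (card {k \<in> {1..p}. covariance M (\<epsilon> p k) (\<epsilon> p i) > \<tau>}) \<le> N \<tau>)"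

definition UDD :: "'a measure \<Rightarrow> (nat \<Rightarrow> nat \<Rightarrow> 'a \<Rightarrow> real) \<Rightarrow> bool" where
  "UDD M \<epsilon> \<longleftrightarrow> (\<exists>N. UDD_bound M \<epsilon> N)"

text \<open>\<open>\<alpha> \<ggreater> \<beta>\<close> for sequences tending to 0. Both are understood to be positive for large
  indices, which users of the relation have to ensure.\<close>

definition much_greater :: "(nat \<Rightarrow> real) \<Rightarrow> (nat \<Rightarrow> real) \<Rightarrow> bool" (infix "\<ggreater>" 50) where
  "\<alpha> \<ggreater> \<beta> \<longleftrightarrow> \<alpha> \<longlonglongrightarrow> 0 \<and> \<beta> \<longlonglongrightarrow> 0 \<and> (\<lambda>p. \<beta> p / \<alpha> p) \<longlonglongrightarrow> 0"

definition std_normal_cdf :: "real \<Rightarrow> real" where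
  "std_normal_cdf = cdf std_normal_distribution"

text \<open>\<open>std_normal_cdf\<close> is a bijection from the reals onto the open unit interval, so
  \<open>normal_quantile p\<close> is the intended value for \<open>p \<ge> 2\<close> and unspecified for \<open>p < 2\<close>.\<close>

definition normal_quantile :: "nat \<Rightarrow> real" where
  "normal_quantile p = inv std_normal_cdf (1 - 1 / real p)"

definition row_max :: "(nat \<Rightarrow> nat \<Rightarrow> 'a \<Rightarrow> real) \<Rightarrow> nat \<Rightarrow> 'a \<Rightarrow> real" where
  "row_max \<epsilon> p \<omega> = Max ((\<lambda>i. \<epsilon> p i \<omega>) ` {1..p})"

end

theory Submission
  imports Defs "HOL-Real_Asymp.Real_Asymp"
begin

text \<open>
  Write \<open>u = normal_quantile p\<close> and let \<open>Q\<close> be the standard normal tail, so \<open>Q u = 1 / p\<close> and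
  \<open>u\<^sup>2\<close> is at least of order \<open>ln p\<close>. The tails at two levels are compared by the inequality
  \<open>Q (x + h) \<le> exp (- x h) Q x\<close> (\<open>normal_tail_shift_le\<close>), used in both directions: raising the
  level from \<open>u\<close> by the relative amount \<open>\<delta>\<close> brings \<open>p Q\<close> from 1 down to at most \<open>exp (- \<delta> u\<^sup>2)\<close>,
  lowering it brings \<open>p Q\<close> up to at least the exponential of a multiple of \<open>\<delta> u\<^sup>2\<close>. Here \<open>\<delta> u\<^sup>2\<close>
  tends to infinity because \<open>\<delta>\<close> dominates \<open>1 / ln p\<close>.

  A maximum that is too large is excluded by the union bound, for any dependence. For a maximum that
  is too small, uniformly decreasing dependence provides at least \<open>p / N \<tau>\<close> indices whose
  pairwise covariances are at most \<open>\<tau>\<close> (\<open>large_sparse_subset\<close>: take a maximal such set). By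
  Slepian's inequality the maximum over these indices is stochastically at least the maximum of the
  equicorrelated variables \<open>sqrt (1 - \<tau>) z\<^sub>i + sqrt \<tau> z\<^sub>0\<close> with independent standard normal
  \<open>z\<^sub>0, z\<^sub>i\<close>. Three effects can lower the latter below \<open>(1 - \<delta>) u\<close>, and \<open>\<delta>\<close> absorbs each of
  them: the factor \<open>sqrt (1 - \<tau>)\<close>, because \<open>\<delta>\<close> dominates \<open>\<tau>\<close>; the common shift, because
  the square \<open>(\<delta> / \<tau>) (\<delta> u\<^sup>2)\<close> of \<open>\<delta> u / sqrt \<tau>\<close> tends to infinity; and the loss of all but
  \<open>p / N \<tau>\<close> indices, because \<open>\<delta> ln p\<close> dominates \<open>ln (N \<tau>) = \<alpha> ln p\<close>.

  Slepian's inequality is proved by rotating \<open>Y\<close> into an independent copy of \<open>Z\<close> along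
  \<open>X = cos \<theta> Y + sin \<theta> Z\<close> and following the expectation of the smooth indicator
  \<open>exp (- \<Sum>j. exp (\<beta> (X\<^sub>j - c)))\<close>. Its \<open>\<theta>\<close>-derivative is a sum of expectations of
  \<open>X'\<^sub>i\<close> times a product of functions of the single \<open>X\<^sub>j\<close>. Gaussian integration by parts would give
  the sign of such an expectation, but a reflection is enough: \<open>U = X'\<^sub>i\<close> has nonnegative covariance
  \<open>\<gamma>\<^sub>j\<close> with each \<open>X\<^sub>j\<close>, and none with \<open>X\<^sub>i\<close>, the map
  \<open>U \<mapsto> - U, X\<^sub>j \<mapsto> X\<^sub>j - 2 \<gamma>\<^sub>j U\<close> preserves the joint Gaussian law, and it moves
  the decreasing factors in the direction of \<open>U\<close> (\<open>gaussian_integral_times_prod_nonpos\<close>). That the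
  reflection preserves the law is read off from joint characteristic functions; the passage from these to
  expectations of products is reduced to the one-dimensional uniqueness theorem
  (\<open>joint_char_eq_imp_integral_prod_eq\<close>).
\<close>

section \<open>Joint laws and characteristic functions\<close>

text \<open>The weights turn the two probability measures into finite measures of the same total mass
  (take \<open>t = 0\<close>). If this mass is positive, normalising gives laws of \<open>U\<close> and \<open>U'\<close> to which
  Levy's uniqueness theorem applies, so both sides are integrals of \<open>g\<close> against the same measure.\<close>
lemma weighted_char_eq_imp_integral_eq:
  fixes U w :: "'a \<Rightarrow> real" and U' w' :: "'b \<Rightarrow> real" and g :: "real \<Rightarrow> real"
  assumes "prob_space M" "prob_space M'"
    and [measurable]: "U \<in> borel_measurable M" "U' \<in> borel_measurable M'"
      "w \<in> borel_measurable M" "w' \<in> borel_measurable M'" "g \<in> borel_measurable borel"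
    and w: "\<And>x. 0 \<le> w x" "\<And>x. w x \<le> B" and w': "\<And>x. 0 \<le> w' x" "\<And>x. w' x \<le> B"
    and eq: "\<And>t. (CLINT x|M. w x * iexp (t * U x)) = (CLINT x|M'. w' x * iexp (t * U' x))"
  shows "(\<integral>x. w x * g (U x) \<partial>M) = (\<integral>x. w' x * g (U' x) \<partial>M')"
proof -
  interpret M: prob_space M by fact
  interpret M': prob_space M' by fact
  define m where "m = (\<integral>x. w x \<partial>M)"
  have int: "integrable M w" using w by (intro M.integrable_const_bound[of _ B]) auto
  have int': "integrable M' w'" using w' by (intro M'.integrable_const_bound[of _ B]) auto
  have m': "m = (\<integral>x. w' x \<partial>M')"
    using eq[of 0] by (simp add: m_def)
  show ?thesis
  proof (cases "m = 0")
    case True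
    have "AE x in M. w x = 0" "AE x in M'. w' x = 0"
      using True m' integral_nonneg_eq_0_iff_AE[OF int] integral_nonneg_eq_0_iff_AE[OF int'] w w'
      by (auto simp: m_def)
    then have "AE x in M. w x * g (U x) = 0" "AE x in M'. w' x * g (U' x) = 0" by auto
    then show ?thesis
      by (simp add: integral_eq_zero_AE)
  next
    case False
    then have "m > 0" unfolding m_def using w(1)
      by (metis Bochner_Integration.integral_nonneg less_eq_real_def)
    define \<nu> where "\<nu> = distr (density M (\<lambda>x. w x / m)) borel U"
    define \<nu>' where "\<nu>' = distr (density M' (\<lambda>x. w' x / m)) borel U'"
    have p: "prob_space (density M (\<lambda>x. w x / m))"
    proof
      have "(\<integral>\<^sup>+x. ennreal (w x / m) \<partial>M) = ennreal (\<integral>x. w x / m \<partial>M)"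
        using int w \<open>m > 0\<close> by (intro nn_integral_eq_integral) auto
      then show "emeasure (density M (\<lambda>x. w x / m)) (space (density M (\<lambda>x. w x / m))) = 1"
        using \<open>m > 0\<close> by (simp add: emeasure_density m_def cong: nn_integral_cong)
    qed
    have p': "prob_space (density M' (\<lambda>x. w' x / m))"
    proof
      have "(\<integral>\<^sup>+x. ennreal (w' x / m) \<partial>M') = ennreal (\<integral>x. w' x / m \<partial>M')"
        using int' w' \<open>m > 0\<close> by (intro nn_integral_eq_integral) auto
      then show "emeasure (density M' (\<lambda>x. w' x / m)) (space (density M' (\<lambda>x. w' x / m))) = 1"
        using \<open>m > 0\<close> by (simp add: emeasure_density m' cong: nn_integral_cong)
    qed
    have "real_distribution \<nu>" "real_distribution \<nu>'"
      unfolding \<nu>_def \<nu>'_def by (auto intro!: prob_space.real_distribution_distr p p')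
    moreover have "char \<nu> = char \<nu>'"
    proof
      fix t
      have "char \<nu> t = (CLINT x|M. (w x / m) *\<^sub>R iexp (t * U x))"
        unfolding \<nu>_def char_def using w \<open>m > 0\<close>
        by (subst integral_distr; simp?) (subst integral_density; simp)
      also have "\<dots> = (CLINT x|M. (w x * iexp (t * U x)) / m)"
        by (simp add: scaleR_conv_of_real)
      also have "\<dots> = (CLINT x|M'. (w' x * iexp (t * U' x)) / m)"
        by (simp only: Bochner_Integration.integral_divide_zero eq)
      also have "\<dots> = (CLINT x|M'. (w' x / m) *\<^sub>R iexp (t * U' x))"
        by (simp add: scaleR_conv_of_real)
      also have "\<dots> = char \<nu>' t"
        unfolding \<nu>'_def char_def using w' \<open>m > 0\<close>
        by (subst integral_distr; simp?) (subst integral_density; simp)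
      finally show "char \<nu> t = char \<nu>' t" .
    qed
    ultimately have "\<nu> = \<nu>'" by (rule Levy_uniqueness)
    have "(\<integral>x. w x * g (U x) \<partial>M) = m * (\<integral>x. (w x / m) *\<^sub>R g (U x) \<partial>M)"
      unfolding Bochner_Integration.integral_mult_right_zero[symmetric]
      using \<open>m > 0\<close> by (intro Bochner_Integration.integral_cong) auto
    also have "(\<integral>x. (w x / m) *\<^sub>R g (U x) \<partial>M) = (\<integral>y. g y \<partial>\<nu>)"
      unfolding \<nu>_def using w \<open>m > 0\<close>
      by (subst integral_distr; simp?) (subst integral_density; simp)
    also have "\<dots> = (\<integral>x. (w' x / m) *\<^sub>R g (U' x) \<partial>M')"
      unfolding \<open>\<nu> = \<nu>'\<close> \<nu>'_def using w' \<open>m > 0\<close>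
      by (subst integral_distr; simp?) (subst integral_density; simp)
    also have "m * \<dots> = (\<integral>x. w' x * g (U' x) \<partial>M')"
      unfolding Bochner_Integration.integral_mult_right_zero[symmetric]
      using \<open>m > 0\<close> by (intro Bochner_Integration.integral_cong) auto
    finally show ?thesis .
  qed
qed

text \<open>Uniqueness for joint characteristic functions, by trading the exponentials for arbitrary bounded
  functions one coordinate at a time. With the factors of \<open>K\<close> already in place, the induction hypothesis,
  read as a function of the frequency of \<open>X k\<close>, is the characteristic function of \<open>X k\<close> under the
  complex weight \<open>\<Prod>i\<in>K. f i (X i)\<close> times an exponential. Its real and imaginary parts are not
  positive, so \<open>weighted_char_eq_imp_integral_eq\<close> is applied to the product times \<open>1 + cos\<close> and
  \<open>1 + sin\<close> instead, and the contribution of the product alone is subtracted.\<close>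
lemma joint_char_eq_imp_integral_prod_iexp_eq:
  fixes U :: "'a \<Rightarrow> real" and U' :: "'b \<Rightarrow> real"
    and X :: "'i \<Rightarrow> 'a \<Rightarrow> real" and X' :: "'i \<Rightarrow> 'b \<Rightarrow> real" and f :: "'i \<Rightarrow> real \<Rightarrow> real"
  assumes "prob_space M" "prob_space M'"
    and U [measurable]: "U \<in> borel_measurable M" "U' \<in> borel_measurable M'"
    and X: "\<And>i. i \<in> I \<Longrightarrow> X i \<in> borel_measurable M" "\<And>i. i \<in> I \<Longrightarrow> X' i \<in> borel_measurable M'"
    and f: "\<And>i. i \<in> I \<Longrightarrow> f i \<in> borel_measurable borel" "\<And>i x. f i x \<in> {0..1}"
    and eq: "\<And>a b. (CLINT \<omega>|M. iexp (a * U \<omega> + (\<Sum>i\<in>I. b i * X i \<omega>)))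
                = (CLINT \<omega>|M'. iexp (a * U' \<omega> + (\<Sum>i\<in>I. b i * X' i \<omega>)))"
    and "finite I" "K \<subseteq> I"
  shows "(CLINT \<omega>|M. complex_of_real (\<Prod>i\<in>K. f i (X i \<omega>)) * iexp (a * U \<omega> + (\<Sum>i\<in>I. b i * X i \<omega>)))
       = (CLINT \<omega>|M'. complex_of_real (\<Prod>i\<in>K. f i (X' i \<omega>)) * iexp (a * U' \<omega> + (\<Sum>i\<in>I. b i * X' i \<omega>)))"
proof -
  have "finite K" using \<open>finite I\<close> \<open>K \<subseteq> I\<close> finite_subset by blast
  then show ?thesis using \<open>K \<subseteq> I\<close>
  proof (induction K arbitrary: a b)
    case empty
    then show ?case using eq by simp
  next
    case (insert k K)
    have "k \<in> I" "K \<subseteq> I" using insert by auto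
    note IH = insert.IH[OF \<open>K \<subseteq> I\<close>]
    interpret M: prob_space M by fact
    interpret M': prob_space M' by fact
    define P where "P = (\<lambda>\<omega>. \<Prod>i\<in>K. f i (X i \<omega>))"
    define P' where "P' = (\<lambda>\<omega>. \<Prod>i\<in>K. f i (X' i \<omega>))"
    define T where "T = (\<lambda>a b \<omega>. a * U \<omega> + (\<Sum>i\<in>I. b i * X i \<omega>))"
    define T' where "T' = (\<lambda>a b \<omega>. a * U' \<omega> + (\<Sum>i\<in>I. b i * X' i \<omega>))"
    have [measurable]: "P \<in> borel_measurable M" "P' \<in> borel_measurable M'"
      unfolding P_def P'_def using \<open>K \<subseteq> I\<close> X f(1)
      by (auto intro!: borel_measurable_prod intro: measurable_compose)
    have [measurable]: "T a b \<in> borel_measurable M" "T' a b \<in> borel_measurable M'" for a b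
      unfolding T_def T'_def using X by (auto intro!: borel_measurable_sum borel_measurable_add borel_measurable_times)
    have [measurable]: "X k \<in> borel_measurable M" "X' k \<in> borel_measurable M'" "f k \<in> borel_measurable borel"
      using \<open>k \<in> I\<close> X f by auto
    have P: "0 \<le> P \<omega>" "P \<omega> \<le> 1" and P': "0 \<le> P' \<omega>'" "P' \<omega>' \<le> 1" for \<omega> \<omega>'
      unfolding P_def P'_def using f(2) by (auto intro!: prod_nonneg prod_le_1)
    have IH: "(CLINT \<omega>|M. P \<omega> * iexp (T a b \<omega>)) = (CLINT \<omega>|M'. P' \<omega> * iexp (T' a b \<omega>))" for a b
      using IH unfolding P_def P'_def T_def T'_def .
    have iP: "integrable M (\<lambda>\<omega>. P \<omega> * iexp (t \<omega>))" if "t \<in> borel_measurable M" for t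
      using P that by (intro M.integrable_const_bound[of _ 1]) (auto simp: norm_mult)
    have iP': "integrable M' (\<lambda>\<omega>. P' \<omega> * iexp (t \<omega>))" if "t \<in> borel_measurable M'" for t
      using P' that by (intro M'.integrable_const_bound[of _ 1]) (auto simp: norm_mult)
    have shift: "T a b \<omega> + s * X k \<omega> = T a (b(k := b k + s)) \<omega>"
      "T' a b \<omega>' + s * X' k \<omega>' = T' a (b(k := b k + s)) \<omega>'" for a b s \<omega> \<omega>'
      using \<open>k \<in> I\<close> \<open>finite I\<close>
      by (simp_all add: T_def T'_def sum.remove[of I k] algebra_simps)
    have IHs: "(CLINT \<omega>|M. P \<omega> * iexp (T a b \<omega> + s * X k \<omega>))
         = (CLINT \<omega>|M'. P' \<omega> * iexp (T' a b \<omega> + s * X' k \<omega>))" for a b s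
      unfolding shift by (rule IH)
    have zero: "T 0 (\<lambda>_. 0) \<omega> = 0" "T' 0 (\<lambda>_. 0) \<omega>' = 0"
      and neg: "T (-a) (\<lambda>i. - b i) \<omega> = - T a b \<omega>" "T' (-a) (\<lambda>i. - b i) \<omega>' = - T' a b \<omega>'" for a b \<omega> \<omega>'
      by (simp_all add: T_def T'_def sum_negf)
    \<comment> \<open>\<open>c = 1\<close> gives the weight with \<open>cos\<close>, \<open>c = -\<i>\<close> the one with \<open>sin\<close>.\<close>
    define W where "W = (\<lambda>c \<omega>. P \<omega> * (1 + Re (c * iexp (T a b \<omega>))))"
    define W' where "W' = (\<lambda>c \<omega>. P' \<omega> * (1 + Re (c * iexp (T' a b \<omega>))))"
    have Wm [measurable]: "W c \<in> borel_measurable M" "W' c \<in> borel_measurable M'" for c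
      unfolding W_def W'_def by measurable
    have Re_bd: "\<bar>Re (c * iexp t)\<bar> \<le> 1" if "cmod c = 1" for c t
      by (rule order_trans[OF abs_Re_le_cmod]) (simp add: norm_mult that)
    have W_bd: "0 \<le> W c \<omega>" "W c \<omega> \<le> 2" "0 \<le> W' c \<omega>'" "W' c \<omega>' \<le> 2" if "cmod c = 1" for c \<omega> \<omega>'
    proof -
      have *: "0 \<le> p * (1 + r)" "p * (1 + r) \<le> 2" if "0 \<le> p" "p \<le> 1" "\<bar>r\<bar> \<le> 1" for p r :: real
        using that mult_mono[of p 1 "1+r" 2] by (auto simp: abs_le_iff)
      show "0 \<le> W c \<omega>" "W c \<omega> \<le> 2" "0 \<le> W' c \<omega>'" "W' c \<omega>' \<le> 2"
        unfolding W_def W'_def using * P P' Re_bd[OF that] by blast+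
    qed
    have expand: "complex_of_real (p * (1 + Re (c * iexp t))) * iexp (s * x)
        = p * iexp (0 + s * x) + (c / 2) * (p * iexp (t + s * x)) + (cnj c / 2) * (p * iexp (- t + s * x))"
      for p t s x c
    proof -
      have "complex_of_real (Re (c * iexp t)) = (c * iexp t + cnj c * iexp (- t)) / 2"
        using complex_add_cnj[of "c * iexp t"] by (simp add: exp_cnj)
      then have weight: "complex_of_real (p * (1 + Re (c * iexp t)))
          = complex_of_real p * (1 + (c * iexp t + cnj c * iexp (- t)) / 2)"
        by (simp only: of_real_mult of_real_add of_real_1)
      have iexp_add: "iexp (y + z) = iexp y * iexp z" for y z
        by (simp add: exp_add distrib_left)
      have "(q * (1 + (c * A + d * A') / 2)) * S = q * S + (c / 2) * (q * (A * S)) + (d / 2) * (q * (A' * S))"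
        for q c d A A' S :: complex
        by (simp add: field_simps)
      then show ?thesis unfolding weight iexp_add add_0 .
    qed
    have lin: "(CLINT \<omega>|R. F \<omega> + c * G \<omega> + d * H \<omega>)
        = (CLINT \<omega>|R. F \<omega>) + c * (CLINT \<omega>|R. G \<omega>) + d * (CLINT \<omega>|R. H \<omega>)"
      if "integrable R F" "integrable R G" "integrable R H"
      for R :: "'z measure" and F G H :: "'z \<Rightarrow> complex" and c d
      using that by simp
    have Wchar: "(CLINT \<omega>|M. W c \<omega> * iexp (s * X k \<omega>)) = (CLINT \<omega>|M'. W' c \<omega> * iexp (s * X' k \<omega>))" for c s
    proof -
      have "(CLINT \<omega>|M. W c \<omega> * iexp (s * X k \<omega>)) = 
         (CLINT \<omega>|M. P \<omega> * iexp (T 0 (\<lambda>_. 0) \<omega> + s * X k \<omega>)) + 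
         (c / 2) * (CLINT \<omega>|M. P \<omega> * iexp (T a b \<omega> + s * X k \<omega>)) + 
         (cnj c / 2) * (CLINT \<omega>|M. P \<omega> * iexp (T (-a) (\<lambda>i. - b i) \<omega> + s * X k \<omega>))"
        unfolding W_def expand zero neg by (intro lin iP) measurable
      also have "\<dots> = 
         (CLINT \<omega>|M'. P' \<omega> * iexp (T' 0 (\<lambda>_. 0) \<omega> + s * X' k \<omega>)) + 
         (c / 2) * (CLINT \<omega>|M'. P' \<omega> * iexp (T' a b \<omega> + s * X' k \<omega>)) + 
         (cnj c / 2) * (CLINT \<omega>|M'. P' \<omega> * iexp (T' (-a) (\<lambda>i. - b i) \<omega> + s * X' k \<omega>))"
        by (simp only: IHs)
      also have "\<dots> = (CLINT \<omega>|M'. W' c \<omega> * iexp (s * X' k \<omega>))"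
        unfolding W'_def expand zero neg by (intro lin[symmetric] iP') measurable
      finally show ?thesis .
    qed
    have Wf: "(\<integral>\<omega>. W c \<omega> * f k (X k \<omega>) \<partial>M) = (\<integral>\<omega>. W' c \<omega> * f k (X' k \<omega>) \<partial>M')" if "cmod c = 1" for c
      using W_bd[OF that] Wchar[of c]
      by (intro weighted_char_eq_imp_integral_eq[where B=2] \<open>prob_space M\<close> \<open>prob_space M'\<close>) auto
    have Pf: "(\<integral>\<omega>. P \<omega> * f k (X k \<omega>) \<partial>M) = (\<integral>\<omega>. P' \<omega> * f k (X' k \<omega>) \<partial>M')"
      using P P' IHs[of 0 "\<lambda>_. 0"]
      by (intro weighted_char_eq_imp_integral_eq[where B=1] \<open>prob_space M\<close> \<open>prob_space M'\<close>) (auto simp: zero)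
    define G where "G = (\<lambda>\<omega>. P \<omega> * f k (X k \<omega>))"
    define G' where "G' = (\<lambda>\<omega>. P' \<omega> * f k (X' k \<omega>))"
    have [measurable]: "G \<in> borel_measurable M" "G' \<in> borel_measurable M'"
      unfolding G_def G'_def by measurable
    have G: "\<bar>G \<omega>\<bar> \<le> 1" "\<bar>G' \<omega>'\<bar> \<le> 1" for \<omega> \<omega>'
      unfolding G_def G'_def abs_mult using P P' f(2)[of k] by (auto intro!: mult_le_one simp: abs_le_iff)
    have iG: "integrable M G" "integrable M' G'"
      using G by (auto intro!: M.integrable_const_bound[of _ 1] M'.integrable_const_bound[of _ 1])
    have iGe: "integrable M (\<lambda>\<omega>. G \<omega> * iexp (T a b \<omega>))" "integrable M' (\<lambda>\<omega>. G' \<omega> * iexp (T' a b \<omega>))"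
      using G by (auto intro!: M.integrable_const_bound[of _ 1] M'.integrable_const_bound[of _ 1] simp: norm_mult)
    have GRe: "Re (c * (CLINT \<omega>|M. G \<omega> * iexp (T a b \<omega>))) = Re (c * (CLINT \<omega>|M'. G' \<omega> * iexp (T' a b \<omega>)))"
      if "cmod c = 1" for c
    proof -
      have le2: "\<bar>w * f k x\<bar> \<le> 2" if "0 \<le> w" "w \<le> 2" for w x
        using that f(2)[of k x] mult_mono[of w 2 "f k x" 1] by (simp add: abs_mult)
      have "Re (c * (CLINT \<omega>|M. G \<omega> * iexp (T a b \<omega>))) = (\<integral>\<omega>. Re (c * (G \<omega> * iexp (T a b \<omega>))) \<partial>M)"
        using iGe by (subst integral_Re) auto
      also have "\<dots> = (\<integral>\<omega>. W c \<omega> * f k (X k \<omega>) - G \<omega> \<partial>M)"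
        by (intro Bochner_Integration.integral_cong refl) (simp add: W_def G_def algebra_simps)
      also have "\<dots> = (\<integral>\<omega>. W c \<omega> * f k (X k \<omega>) \<partial>M) - (\<integral>\<omega>. G \<omega> \<partial>M)"
      proof (rule Bochner_Integration.integral_diff[OF _ iG(1)])
        show "integrable M (\<lambda>\<omega>. W c \<omega> * f k (X k \<omega>))"
          using le2 W_bd(1,2)[OF that] by (intro M.integrable_const_bound[of _ 2]) auto
      qed
      also have "\<dots> = (\<integral>\<omega>. W' c \<omega> * f k (X' k \<omega>) \<partial>M') - (\<integral>\<omega>. G' \<omega> \<partial>M')"
        using Wf[OF that] Pf by (simp add: G_def G'_def)
      also have "\<dots> = (\<integral>\<omega>. W' c \<omega> * f k (X' k \<omega>) - G' \<omega> \<partial>M')"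
      proof (rule Bochner_Integration.integral_diff[OF _ iG(2), symmetric])
        show "integrable M' (\<lambda>\<omega>. W' c \<omega> * f k (X' k \<omega>))"
          using le2 W_bd(3,4)[OF that] by (intro M'.integrable_const_bound[of _ 2]) auto
      qed
      also have "\<dots> = (\<integral>\<omega>. Re (c * (G' \<omega> * iexp (T' a b \<omega>))) \<partial>M')"
        by (intro Bochner_Integration.integral_cong refl) (simp add: W'_def G'_def algebra_simps)
      also have "\<dots> = Re (c * (CLINT \<omega>|M'. G' \<omega> * iexp (T' a b \<omega>)))"
        using iGe by (subst integral_Re) auto
      finally show ?thesis .
    qed
    have "(CLINT \<omega>|M. G \<omega> * iexp (T a b \<omega>)) = (CLINT \<omega>|M'. G' \<omega> * iexp (T' a b \<omega>))"
      using GRe[of 1] GRe[of "-\<i>"] by (intro complex_eqI) auto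
    then show ?case
      using insert.hyps unfolding G_def G'_def P_def P'_def T_def T'_def by (simp add: mult_ac)
  qed
qed

lemma joint_char_eq_imp_integral_prod_eq:
  fixes U :: "'a \<Rightarrow> real" and U' :: "'b \<Rightarrow> real"
    and X :: "'i \<Rightarrow> 'a \<Rightarrow> real" and X' :: "'i \<Rightarrow> 'b \<Rightarrow> real" and f :: "'i \<Rightarrow> real \<Rightarrow> real"
  assumes "prob_space M" "prob_space M'"
    and U: "U \<in> borel_measurable M" "U' \<in> borel_measurable M'"
    and X: "\<And>i. i \<in> I \<Longrightarrow> X i \<in> borel_measurable M" "\<And>i. i \<in> I \<Longrightarrow> X' i \<in> borel_measurable M'"
    and f: "\<And>i. i \<in> I \<Longrightarrow> f i \<in> borel_measurable borel" "\<And>i x. f i x \<in> {0..1}"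
    and "finite I"
    and eq: "\<And>a b. (CLINT \<omega>|M. iexp (a * U \<omega> + (\<Sum>i\<in>I. b i * X i \<omega>)))
                = (CLINT \<omega>|M'. iexp (a * U' \<omega> + (\<Sum>i\<in>I. b i * X' i \<omega>)))"
  shows "(\<integral>\<omega>. (\<Prod>i\<in>I. f i (X i \<omega>)) * U \<omega> \<partial>M) = (\<integral>\<omega>. (\<Prod>i\<in>I. f i (X' i \<omega>)) * U' \<omega> \<partial>M')"
proof (rule weighted_char_eq_imp_integral_eq[where g = "\<lambda>x. x" and B = 1])
  fix t
  show "(CLINT \<omega>|M. (\<Prod>i\<in>I. f i (X i \<omega>)) * iexp (t * U \<omega>))
      = (CLINT \<omega>|M'. (\<Prod>i\<in>I. f i (X' i \<omega>)) * iexp (t * U' \<omega>))"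
    using joint_char_eq_imp_integral_prod_iexp_eq[OF assms(1-8) eq \<open>finite I\<close> order_refl, where a = t and b = "\<lambda>_. 0"]
    by simp
next
  show "(\<lambda>\<omega>. \<Prod>i\<in>I. f i (X i \<omega>)) \<in> borel_measurable M" "(\<lambda>\<omega>. \<Prod>i\<in>I. f i (X' i \<omega>)) \<in> borel_measurable M'"
    using X f(1) by (auto intro!: borel_measurable_prod intro: measurable_compose)
  show "0 \<le> (\<Prod>i\<in>I. f i (X i \<omega>))" "(\<Prod>i\<in>I. f i (X i \<omega>)) \<le> 1" for \<omega>
    using f(2) by (auto intro!: prod_nonneg prod_le_1)
  show "0 \<le> (\<Prod>i\<in>I. f i (X' i \<omega>))" "(\<Prod>i\<in>I. f i (X' i \<omega>)) \<le> 1" for \<omega>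
    using f(2) by (auto intro!: prod_nonneg prod_le_1)
qed (use assms in auto)

section \<open>Slepian's inequality\<close>

text \<open>The characteristic function in the hypothesis says that \<open>(U, X)\<close> is centred Gaussian, that \<open>U\<close> has
  variance 1, and that \<open>\<gamma> j\<close> is the covariance of \<open>U\<close> and \<open>X j\<close>; \<open>Q\<close> is the quadratic form of
  \<open>X\<close>. The variables \<open>X j - \<gamma> j U\<close> are uncorrelated with \<open>U\<close>, so replacing \<open>U\<close> by \<open>- U\<close> and
  \<open>X j\<close> by \<open>X j - 2 \<gamma> j U\<close> does not change the law. The expectation is therefore half the
  expectation of \<open>U\<close> times the difference of the two products, and where \<open>U\<close> is positive the reflected
  product is the larger one.\<close>
lemma gaussian_integral_times_prod_nonpos:
  fixes U :: "'a \<Rightarrow> real" and X :: "'i \<Rightarrow> 'a \<Rightarrow> real" and f :: "'i \<Rightarrow> real \<Rightarrow> real"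
    and \<gamma> :: "'i \<Rightarrow> real" and Q :: "('i \<Rightarrow> real) \<Rightarrow> real"
  assumes "prob_space M"
    and intU: "integrable M U" and X: "\<And>j. j \<in> I \<Longrightarrow> X j \<in> borel_measurable M"
    and "finite I"
    and ch: "\<And>a b. (CLINT \<omega>|M. iexp (a * U \<omega> + (\<Sum>j\<in>I. b j * X j \<omega>)))
              = exp (- (a\<^sup>2 + 2 * a * (\<Sum>j\<in>I. \<gamma> j * b j) + Q b) / 2)"
    and \<gamma>: "\<And>j. j \<in> I \<Longrightarrow> \<gamma> j \<ge> 0"
    and f: "\<And>j. j \<in> I \<Longrightarrow> f j \<in> borel_measurable borel" "\<And>j x. f j x \<in> {0..1}"
    and f_anti: "\<And>j. j \<in> I \<Longrightarrow> \<gamma> j = 0 \<or> antimono (f j)"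
  shows "(\<integral>\<omega>. (\<Prod>j\<in>I. f j (X j \<omega>)) * U \<omega> \<partial>M) \<le> 0"
proof -
  interpret prob_space M by fact
  define X' where "X' = (\<lambda>j \<omega>. X j \<omega> - 2 * \<gamma> j * U \<omega>)"
  have [measurable]: "U \<in> borel_measurable M" using intU by auto
  have X'm: "\<And>j. j \<in> I \<Longrightarrow> X' j \<in> borel_measurable M" unfolding X'_def using X by auto
  have eq: "(\<integral>\<omega>. (\<Prod>j\<in>I. f j (X j \<omega>)) * U \<omega> \<partial>M) = (\<integral>\<omega>. (\<Prod>j\<in>I. f j (X' j \<omega>)) * (- U \<omega>) \<partial>M)"
  proof (rule joint_char_eq_imp_integral_prod_eq[where U = U and U' = "\<lambda>\<omega>. - U \<omega>" and X = X and X' = X' and f = f])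
    fix a b
    define B where "B = (\<Sum>j\<in>I. \<gamma> j * b j)"
    have "a * - U \<omega> + (\<Sum>j\<in>I. b j * X' j \<omega>) = (- a - 2 * B) * U \<omega> + (\<Sum>j\<in>I. b j * X j \<omega>)" for \<omega>
      by (simp add: X'_def B_def algebra_simps sum_subtractf sum_distrib_left)
    then have "(CLINT \<omega>|M. iexp (a * - U \<omega> + (\<Sum>j\<in>I. b j * X' j \<omega>)))
        = exp (- ((- a - 2 * B)\<^sup>2 + 2 * (- a - 2 * B) * B + Q b) / 2)"
      using ch[of "- a - 2 * B" b] by (simp add: B_def)
    also have "(- a - 2 * B)\<^sup>2 + 2 * (- a - 2 * B) * B = a\<^sup>2 + 2 * a * B"
      by (simp add: power2_eq_square algebra_simps)
    finally show "(CLINT \<omega>|M. iexp (a * U \<omega> + (\<Sum>j\<in>I. b j * X j \<omega>)))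
        = (CLINT \<omega>|M. iexp (a * - U \<omega> + (\<Sum>j\<in>I. b j * X' j \<omega>)))"
      by (simp only: ch B_def)
  qed (use assms X'm in auto)
  have pm: "(\<lambda>\<omega>. \<Prod>j\<in>I. f j (X j \<omega>)) \<in> borel_measurable M" "(\<lambda>\<omega>. \<Prod>j\<in>I. f j (X' j \<omega>)) \<in> borel_measurable M"
    using X X'm f(1) by (auto intro!: borel_measurable_prod intro: measurable_compose)
  have pb: "\<bar>\<Prod>j\<in>I. f j (Y j)\<bar> \<le> 1" for Y
    using f(2) by (auto simp: abs_le_iff intro!: prod_le_1 order_trans[OF _ prod_nonneg])
  have int: "integrable M (\<lambda>\<omega>. (\<Prod>j\<in>I. f j (X j \<omega>)) * U \<omega>)" "integrable M (\<lambda>\<omega>. (\<Prod>j\<in>I. f j (X' j \<omega>)) * (- U \<omega>))"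
    using pm pb by (auto intro!: Bochner_Integration.integrable_bound[OF intU] AE_I2 mult_left_le_one_le simp: abs_mult)
  have "2 * (\<integral>\<omega>. (\<Prod>j\<in>I. f j (X j \<omega>)) * U \<omega> \<partial>M)
      = (\<integral>\<omega>. (\<Prod>j\<in>I. f j (X j \<omega>)) * U \<omega> + (\<Prod>j\<in>I. f j (X' j \<omega>)) * (- U \<omega>) \<partial>M)"
    using eq by (subst Bochner_Integration.integral_add[OF int]) simp
  also have "\<dots> \<le> (\<integral>\<omega>. 0 \<partial>M)"
  proof (rule integral_mono[OF Bochner_Integration.integrable_add[OF int] integrable_zero])
    fix \<omega>
    have f0: "f j x \<ge> 0" for j x using f(2)[of j x] by simp
    have "((\<Prod>j\<in>I. f j (X j \<omega>)) - (\<Prod>j\<in>I. f j (X' j \<omega>))) * U \<omega> \<le> 0"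
    proof (cases "U \<omega> \<ge> 0")
      case True
      have "(\<Prod>j\<in>I. f j (X j \<omega>)) \<le> (\<Prod>j\<in>I. f j (X' j \<omega>))"
      proof (rule prod_mono, safe)
        fix j assume "j \<in> I"
        then show "f j (X j \<omega>) \<le> f j (X' j \<omega>)"
          using f_anti[of j] \<gamma>[of j] True by (auto simp: X'_def antimono_def)
      qed (rule f0)
      then show ?thesis using True by (simp add: mult_nonpos_nonneg)
    next
      case False
      have "(\<Prod>j\<in>I. f j (X' j \<omega>)) \<le> (\<Prod>j\<in>I. f j (X j \<omega>))"
      proof (rule prod_mono, safe)
        fix j assume "j \<in> I"
        then show "f j (X' j \<omega>) \<le> f j (X j \<omega>)"
          using f_anti[of j] \<gamma>[of j] False by (auto simp: X'_def antimono_def mult_nonneg_nonpos)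
      qed (rule f0)
      then show ?thesis using False by (simp add: mult_nonneg_nonpos)
    qed
    then show "(\<Prod>j\<in>I. f j (X j \<omega>)) * U \<omega> + (\<Prod>j\<in>I. f j (X' j \<omega>)) * (- U \<omega>) \<le> 0"
      by (simp add: algebra_simps)
  qed
  finally show ?thesis by simp
qed

text \<open>Centred Gaussian vectors with covariance matrix \<open>R\<close>, described by their characteristic function
  because combining independent vectors then amounts to adding quadratic forms. Integrability also carries
  the measurability of the components.\<close>
definition gaussian_vector :: "'a measure \<Rightarrow> 'i set \<Rightarrow> ('i \<Rightarrow> 'a \<Rightarrow> real) \<Rightarrow> ('i \<Rightarrow> 'i \<Rightarrow> real) \<Rightarrow> bool" where
  "gaussian_vector M I X R \<longleftrightarrow>
     (\<forall>i\<in>I. integrable M (X i)) \<and> (\<forall>i\<in>I. \<forall>j\<in>I. R i j = R j i) \<and>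
     (\<forall>a. (CLINT \<omega>|M. iexp (\<Sum>i\<in>I. a i * X i \<omega>)) = exp (- (\<Sum>i\<in>I. \<Sum>j\<in>I. a i * a j * R i j) / 2))"

lemma quadratic_form_add_single:
  fixes R :: "'i \<Rightarrow> 'i \<Rightarrow> real"
  assumes "finite I" "i \<in> I" and sym: "\<And>k j. k \<in> I \<Longrightarrow> j \<in> I \<Longrightarrow> R k j = R j k"
  shows "(\<Sum>k\<in>I. \<Sum>j\<in>I. (s * b k + (if k = i then t else 0)) * (s * b j + (if j = i then t else 0)) * R k j)
    = s\<^sup>2 * (\<Sum>k\<in>I. \<Sum>j\<in>I. b k * b j * R k j) + 2 * s * t * (\<Sum>j\<in>I. R i j * b j) + t\<^sup>2 * R i i"
proof -
  have if_mult: "(if P then t else 0) * x = (if P then t * x else 0)" "x * (if P then t else 0) = (if P then x * t else 0)" for P x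
    by auto
  have "(\<Sum>k\<in>I. \<Sum>j\<in>I. (s * b k + (if k = i then t else 0)) * (s * b j + (if j = i then t else 0)) * R k j)
     = (\<Sum>k\<in>I. \<Sum>j\<in>I. s\<^sup>2 * (b k * b j * R k j)) + (\<Sum>k\<in>I. \<Sum>j\<in>I. (if k = i then t * s * b j * R k j else 0))
     + (\<Sum>k\<in>I. \<Sum>j\<in>I. (if j = i then t * s * b k * R k j else 0))
     + (\<Sum>k\<in>I. \<Sum>j\<in>I. (if k = i then if j = i then t\<^sup>2 * R k j else 0 else 0))"
    unfolding sum.distrib[symmetric]
    by (intro sum.cong refl) (auto simp: algebra_simps power2_eq_square)
  also have "(\<Sum>k\<in>I. \<Sum>j\<in>I. (if k = i then t * s * b j * R k j else 0)) = (\<Sum>j\<in>I. t * s * b j * R i j)"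
    using assms(1,2) by (subst sum.swap) simp
  also have "(\<Sum>k\<in>I. \<Sum>j\<in>I. (if j = i then t * s * b k * R k j else 0)) = (\<Sum>j\<in>I. t * s * b j * R i j)"
    using assms by (simp cong: sum.cong)
  also have "(\<Sum>k\<in>I. \<Sum>j\<in>I. (if k = i then if j = i then t\<^sup>2 * R k j else 0 else 0)) = t\<^sup>2 * R i i"
  proof -
    have "(\<Sum>k\<in>I. \<Sum>j\<in>I. (if k = i then if j = i then t\<^sup>2 * R k j else 0 else 0))
       = (\<Sum>k\<in>I. if k = i then t\<^sup>2 * R i i else 0)"
      using assms(1,2) by (intro sum.cong refl) simp
    then show ?thesis using assms(1,2) by simp
  qed
  finally show ?thesis
    by (simp add: sum_distrib_left mult_ac)
qed

lemma (in pair_prob_space) integral_prod_iexp: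
  assumes [measurable]: "f \<in> borel_measurable M1" "g \<in> borel_measurable M2"
  shows "(CLINT \<omega>|M1 \<Otimes>\<^sub>M M2. iexp (f (fst \<omega>) + g (snd \<omega>))) = (CLINT x|M1. iexp (f x)) * (CLINT y|M2. iexp (g y))"
proof -
  have "(CLINT \<omega>|M1 \<Otimes>\<^sub>M M2. iexp (f (fst \<omega>) + g (snd \<omega>))) = (CLINT x|M1. CLINT y|M2. iexp (f x + g y))"
    by (subst integral_fst'[symmetric]) (auto intro!: P.integrable_const_bound[of _ 1])
  also have "\<dots> = (CLINT x|M1. CLINT y|M2. iexp (f x) * iexp (g y))"
    by (simp add: exp_add distrib_left)
  finally show ?thesis by simp
qed

text \<open>The joint characteristic function of \<open>X'\<^sub>i = - sin \<theta> Y\<^sub>i + cos \<theta> Z\<^sub>i\<close> and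
  \<open>X = cos \<theta> Y + sin \<theta> Z\<close>, in the form required by \<open>gaussian_integral_times_prod_nonpos\<close>. The equal
  diagonals make the variance of \<open>X'\<^sub>i\<close> equal to 1 and its covariance with \<open>X\<^sub>i\<close> equal to 0; the
  covariance with \<open>X\<^sub>j\<close> is \<open>sin \<theta> cos \<theta> (C i j - R i j)\<close>.\<close>
lemma interpolation_char:
  fixes Y :: "'i \<Rightarrow> 'a \<Rightarrow> real" and Z :: "'i \<Rightarrow> 'b \<Rightarrow> real"
  assumes "prob_space M" "prob_space P" "finite I" "i \<in> I"
    and Y: "gaussian_vector M I Y R" and Z: "gaussian_vector P I Z C"
    and diag: "R i i = 1" "C i i = 1"
  shows "(CLINT \<omega>|M \<Otimes>\<^sub>M P. iexp (a * (- sin \<theta> * Y i (fst \<omega>) + cos \<theta> * Z i (snd \<omega>))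
            + (\<Sum>j\<in>I. b j * (cos \<theta> * Y j (fst \<omega>) + sin \<theta> * Z j (snd \<omega>)))))
    = exp (- (a\<^sup>2 + 2 * a * (\<Sum>j\<in>I. (sin \<theta> * cos \<theta> * (C i j - R i j)) * b j)
          + ((cos \<theta>)\<^sup>2 * (\<Sum>k\<in>I. \<Sum>j\<in>I. b k * b j * R k j) + (sin \<theta>)\<^sup>2 * (\<Sum>k\<in>I. \<Sum>j\<in>I. b k * b j * C k j))) / 2)"
proof -
  interpret M: prob_space M by fact
  interpret P: prob_space P by fact
  interpret MP: pair_prob_space M P ..
  define p where "p = (\<lambda>k. cos \<theta> * b k + (if k = i then - a * sin \<theta> else 0))"
  define q where "q = (\<lambda>k. sin \<theta> * b k + (if k = i then a * cos \<theta> else 0))"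
  define A where "A = (\<Sum>j\<in>I. R i j * b j)"
  define B where "B = (\<Sum>j\<in>I. C i j * b j)"
  have split: "a * (- sin \<theta> * y i + cos \<theta> * z i) + (\<Sum>j\<in>I. b j * (cos \<theta> * y j + sin \<theta> * z j))
     = (\<Sum>j\<in>I. p j * y j) + (\<Sum>j\<in>I. q j * z j)" for y z
  proof -
    have "p j * y j + q j * z j = b j * (cos \<theta> * y j + sin \<theta> * z j) + (if j = i then a * (- sin \<theta> * y i + cos \<theta> * z i) else 0)" for j
      by (simp add: p_def q_def algebra_simps)
    then show ?thesis
      using \<open>finite I\<close> \<open>i \<in> I\<close> by (simp flip: sum.distrib) (simp add: sum.distrib)
  qed
  have "(CLINT \<omega>|M \<Otimes>\<^sub>M P. iexp (a * (- sin \<theta> * Y i (fst \<omega>) + cos \<theta> * Z i (snd \<omega>))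
            + (\<Sum>j\<in>I. b j * (cos \<theta> * Y j (fst \<omega>) + sin \<theta> * Z j (snd \<omega>)))))
     = (CLINT \<omega>|M \<Otimes>\<^sub>M P. iexp ((\<Sum>j\<in>I. p j * Y j (fst \<omega>)) + (\<Sum>j\<in>I. q j * Z j (snd \<omega>))))"
    unfolding split[of "\<lambda>j. Y j (fst \<omega>)" "\<lambda>j. Z j (snd \<omega>)" for \<omega>] ..
  also have "\<dots> = (CLINT x|M. iexp (\<Sum>j\<in>I. p j * Y j x)) * (CLINT y|P. iexp (\<Sum>j\<in>I. q j * Z j y))"
    using Y Z unfolding gaussian_vector_def
    by (intro MP.integral_prod_iexp borel_measurable_sum borel_measurable_times) auto
  also have "\<dots> = exp (- (\<Sum>k\<in>I. \<Sum>j\<in>I. p k * p j * R k j) / 2 + - (\<Sum>k\<in>I. \<Sum>j\<in>I. q k * q j * C k j) / 2)"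
    using Y Z unfolding gaussian_vector_def by (simp only: exp_add of_real_mult)
  also have "(\<Sum>k\<in>I. \<Sum>j\<in>I. p k * p j * R k j)
     = (cos \<theta>)\<^sup>2 * (\<Sum>k\<in>I. \<Sum>j\<in>I. b k * b j * R k j) + 2 * cos \<theta> * (- a * sin \<theta>) * A + (- a * sin \<theta>)\<^sup>2"
    unfolding p_def A_def using Y assms(3,4) diag(1)
    by (subst quadratic_form_add_single) (auto simp: gaussian_vector_def)
  also have "(\<Sum>k\<in>I. \<Sum>j\<in>I. q k * q j * C k j)
     = (sin \<theta>)\<^sup>2 * (\<Sum>k\<in>I. \<Sum>j\<in>I. b k * b j * C k j) + 2 * sin \<theta> * (a * cos \<theta>) * B + (a * cos \<theta>)\<^sup>2"
    unfolding q_def B_def using Z assms(3,4) diag(2)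
    by (subst quadratic_form_add_single) (auto simp: gaussian_vector_def)
  finally have main: "(CLINT \<omega>|M \<Otimes>\<^sub>M P. iexp (a * (- sin \<theta> * Y i (fst \<omega>) + cos \<theta> * Z i (snd \<omega>))
            + (\<Sum>j\<in>I. b j * (cos \<theta> * Y j (fst \<omega>) + sin \<theta> * Z j (snd \<omega>)))))
     = complex_of_real (exp (- ((cos \<theta>)\<^sup>2 * (\<Sum>k\<in>I. \<Sum>j\<in>I. b k * b j * R k j) + 2 * cos \<theta> * (- a * sin \<theta>) * A + (- a * sin \<theta>)\<^sup>2) / 2
       + - ((sin \<theta>)\<^sup>2 * (\<Sum>k\<in>I. \<Sum>j\<in>I. b k * b j * C k j) + 2 * sin \<theta> * (a * cos \<theta>) * B + (a * cos \<theta>)\<^sup>2) / 2))" .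
  have BA: "(\<Sum>j\<in>I. (sin \<theta> * cos \<theta> * (C i j - R i j)) * b j) = sin \<theta> * cos \<theta> * (B - A)"
    unfolding A_def B_def by (simp add: sum_distrib_left sum_subtractf algebra_simps)
  have "(a * sin \<theta>)\<^sup>2 + (a * cos \<theta>)\<^sup>2 = a\<^sup>2"
    using sin_cos_squared_add[of \<theta>] by (metis power_mult_distrib distrib_left mult.right_neutral)
  then have "- (u + 2 * cos \<theta> * (- a * sin \<theta>) * A + (- a * sin \<theta>)\<^sup>2) / 2 + - (v + 2 * sin \<theta> * (a * cos \<theta>) * B + (a * cos \<theta>)\<^sup>2) / 2
     = - (a\<^sup>2 + 2 * a * (sin \<theta> * cos \<theta> * (B - A)) + (u + v)) / 2" for u v
    by (simp add: field_simps)
  then show ?thesis unfolding main BA by (simp only:)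
qed

lemma (in pair_prob_space) integrable_comp_fst:
  fixes f :: "'a \<Rightarrow> real"
  assumes "integrable M1 f"
  shows "integrable (M1 \<Otimes>\<^sub>M M2) (\<lambda>\<omega>. f (fst \<omega>))"
  using assms by (intro Fubini_integrable) auto

lemma (in pair_prob_space) integrable_comp_snd:
  fixes f :: "'b \<Rightarrow> real"
  assumes "integrable M2 f"
  shows "integrable (M1 \<Otimes>\<^sub>M M2) (\<lambda>\<omega>. f (snd \<omega>))"
  using assms by (intro Fubini_integrable) auto

text \<open>The factor \<open>exp (\<beta> (x - c))\<close> destroys monotonicity only in the coordinate \<open>i\<close>, with which
  \<open>X'\<^sub>i\<close> is uncorrelated. It is bounded after multiplication by its own factor of the exponential of the
  sum, since \<open>e exp (- e) \<le> 1\<close>.\<close>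
lemma gaussian_interpolation_drift_nonpos:
  fixes Y :: "'i \<Rightarrow> 'a \<Rightarrow> real" and Z :: "'i \<Rightarrow> 'b \<Rightarrow> real"
  assumes "prob_space M" "prob_space P" "finite I" "i \<in> I"
    and Y: "gaussian_vector M I Y R" and Z: "gaussian_vector P I Z C"
    and diag: "\<And>i. i \<in> I \<Longrightarrow> R i i = 1" "\<And>i. i \<in> I \<Longrightarrow> C i i = 1"
    and le: "\<And>i j. i \<in> I \<Longrightarrow> j \<in> I \<Longrightarrow> R i j \<le> C i j"
    and \<theta>: "0 \<le> \<theta>" "\<theta> \<le> pi / 2" and "\<beta> > 0"
  defines "X \<equiv> \<lambda>j \<omega>. cos \<theta> * Y j (fst \<omega>) + sin \<theta> * Z j (snd \<omega>)"
  shows "(\<integral>\<omega>. exp (\<beta> * (X i \<omega> - c)) * exp (- (\<Sum>j\<in>I. exp (\<beta> * (X j \<omega> - c))))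
            * (- sin \<theta> * Y i (fst \<omega>) + cos \<theta> * Z i (snd \<omega>)) \<partial>(M \<Otimes>\<^sub>M P)) \<le> 0"
proof -
  interpret M: prob_space M by fact
  interpret P: prob_space P by fact
  interpret MP: pair_prob_space M P ..
  define E where "E = (\<lambda>x::real. exp (\<beta> * (x - c)))"
  define f where "f = (\<lambda>j x. if j = i then E x * exp (- E x) else exp (- E x))"
  have [measurable]: "E \<in> borel_measurable borel" unfolding E_def by measurable
  have "(\<Prod>j\<in>I. f j (x j)) = E (x i) * exp (- (\<Sum>j\<in>I. E (x j)))" for x
  proof -
    have "(\<Prod>j\<in>I. f j (x j)) = f i (x i) * (\<Prod>j\<in>I - {i}. f j (x j))"
      using \<open>finite I\<close> \<open>i \<in> I\<close> by (rule prod.remove)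
    also have "(\<Prod>j\<in>I - {i}. f j (x j)) = (\<Prod>j\<in>I - {i}. exp (- E (x j)))"
      by (intro prod.cong) (auto simp: f_def)
    also have "\<dots> = exp (- (\<Sum>j\<in>I - {i}. E (x j)))"
      using \<open>finite I\<close> by (simp add: exp_sum flip: sum_negf)
    finally show ?thesis
      using \<open>finite I\<close> \<open>i \<in> I\<close> by (simp add: f_def sum.remove[of I i] exp_add[symmetric] mult.assoc)
  qed
  moreover have "(\<integral>\<omega>. (\<Prod>j\<in>I. f j (X j \<omega>)) * (- sin \<theta> * Y i (fst \<omega>) + cos \<theta> * Z i (snd \<omega>)) \<partial>(M \<Otimes>\<^sub>M P)) \<le> 0"
  proof (rule gaussian_integral_times_prod_nonpos[where \<gamma> = "\<lambda>j. sin \<theta> * cos \<theta> * (C i j - R i j)"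
        and Q = "\<lambda>b. (cos \<theta>)\<^sup>2 * (\<Sum>k\<in>I. \<Sum>j\<in>I. b k * b j * R k j) + (sin \<theta>)\<^sup>2 * (\<Sum>k\<in>I. \<Sum>j\<in>I. b k * b j * C k j)"
        and f = f and X = X])
    show "prob_space (M \<Otimes>\<^sub>M P)" by unfold_locales
    show "integrable (M \<Otimes>\<^sub>M P) (\<lambda>\<omega>. - sin \<theta> * Y i (fst \<omega>) + cos \<theta> * Z i (snd \<omega>))"
      using Y Z \<open>i \<in> I\<close> unfolding gaussian_vector_def
      by (intro Bochner_Integration.integrable_add integrable_mult_right MP.integrable_comp_fst MP.integrable_comp_snd) auto
    show "X j \<in> borel_measurable (M \<Otimes>\<^sub>M P)" if "j \<in> I" for j
    proof -
      have [measurable]: "Y j \<in> borel_measurable M" "Z j \<in> borel_measurable P"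
        using Y Z that by (auto simp: gaussian_vector_def)
      show ?thesis unfolding X_def by measurable
    qed
    show "0 \<le> sin \<theta> * cos \<theta> * (C i j - R i j)" if "j \<in> I" for j
      using le[OF \<open>i \<in> I\<close> that] \<theta> by (auto intro!: mult_nonneg_nonneg sin_ge_zero cos_ge_zero)
    show "f j \<in> borel_measurable borel" for j
      unfolding f_def by (cases "j = i") simp_all
    show "f j x \<in> {0..1}" for j x
    proof -
      have "E x > 0" by (simp add: E_def)
      moreover have "E x \<le> exp (E x)" using exp_ge_add_one_self[of "E x"] by linarith
      ultimately show ?thesis by (auto simp: f_def exp_minus field_simps)
    qed
    show "sin \<theta> * cos \<theta> * (C i j - R i j) = 0 \<or> antimono (f j)" if "j \<in> I" for j
      using diag[OF that] \<open>\<beta> > 0\<close> by (auto simp: f_def E_def antimono_def)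
    show "(CLINT \<omega>|M \<Otimes>\<^sub>M P. iexp (a * (- sin \<theta> * Y i (fst \<omega>) + cos \<theta> * Z i (snd \<omega>)) + (\<Sum>j\<in>I. b j * X j \<omega>)))
      = exp (- (a\<^sup>2 + 2 * a * (\<Sum>j\<in>I. (sin \<theta> * cos \<theta> * (C i j - R i j)) * b j)
          + ((cos \<theta>)\<^sup>2 * (\<Sum>k\<in>I. \<Sum>j\<in>I. b k * b j * R k j) + (sin \<theta>)\<^sup>2 * (\<Sum>k\<in>I. \<Sum>j\<in>I. b k * b j * C k j))) / 2)"
      for a b
      unfolding X_def by (rule interpolation_char[OF assms(1-6) diag(1)[OF \<open>i \<in> I\<close>] diag(2)[OF \<open>i \<in> I\<close>]])
  qed fact
  ultimately show ?thesis by (simp add: E_def)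
qed

text \<open>The difference of the two sides is the integral over \<open>\<theta> \<in> [0, \<pi>/2]\<close> of the derivative \<open>h\<close>
  along the rotation. Integrating \<open>h\<close> in \<open>\<theta>\<close> for fixed \<open>\<omega>\<close> and using Fubini avoids
  differentiating under the expectation.\<close>
lemma gaussian_comparison_exp_sum:
  fixes Y :: "'i \<Rightarrow> 'a \<Rightarrow> real" and Z :: "'i \<Rightarrow> 'b \<Rightarrow> real"
  assumes "prob_space M" "prob_space P" "finite I"
    and Y: "gaussian_vector M I Y R" and Z: "gaussian_vector P I Z C"
    and diag: "\<And>i. i \<in> I \<Longrightarrow> R i i = 1" "\<And>i. i \<in> I \<Longrightarrow> C i i = 1"
    and le: "\<And>i j. i \<in> I \<Longrightarrow> j \<in> I \<Longrightarrow> R i j \<le> C i j" and "\<beta> > 0"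
  shows "(\<integral>\<omega>. exp (- (\<Sum>j\<in>I. exp (\<beta> * (Y j \<omega> - c)))) \<partial>M) \<le> (\<integral>\<omega>. exp (- (\<Sum>j\<in>I. exp (\<beta> * (Z j \<omega> - c)))) \<partial>P)"
proof -
  interpret M: prob_space M by fact
  interpret P: prob_space P by fact
  interpret MP: pair_prob_space M P ..
  interpret Q: pair_sigma_finite "M \<Otimes>\<^sub>M P" lborel ..
  define X where "X = (\<lambda>\<theta> j \<omega>. cos \<theta> * Y j (fst \<omega>) + sin \<theta> * Z j (snd \<omega>))"
  define X' where "X' = (\<lambda>\<theta> j \<omega>. - sin \<theta> * Y j (fst \<omega>) + cos \<theta> * Z j (snd \<omega>))"
  define F where "F = (\<lambda>x :: 'i \<Rightarrow> real. exp (- (\<Sum>j\<in>I. exp (\<beta> * (x j - c)))))"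
  define h where "h = (\<lambda>\<theta> \<omega>. - \<beta> * (\<Sum>i\<in>I. exp (\<beta> * (X \<theta> i \<omega> - c)) * F (\<lambda>j. X \<theta> j \<omega>) * X' \<theta> i \<omega>))"
  define G where "G = (\<lambda>\<omega>. \<beta> * (\<Sum>i\<in>I. \<bar>Y i (fst \<omega>)\<bar> + \<bar>Z i (snd \<omega>)\<bar>))"
  have int: "integrable M (Y j)" "integrable P (Z j)" if "j \<in> I" for j
    using Y Z that by (auto simp: gaussian_vector_def)
  then have [measurable]: "Y j \<in> borel_measurable M" "Z j \<in> borel_measurable P" if "j \<in> I" for j
    using that by auto
  have intG: "integrable (M \<Otimes>\<^sub>M P) G"
    unfolding G_def using int
    by (intro integrable_mult_right Bochner_Integration.integrable_sum Bochner_Integration.integrable_add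
         integrable_abs MP.integrable_comp_fst MP.integrable_comp_snd) auto
  have Fpos: "0 < F x" "F x \<le> 1" for x
    unfolding F_def by (auto intro!: sum_nonneg)
  have eF: "exp (\<beta> * (x i - c)) * F x \<le> 1" if "i \<in> I" for x i
  proof -
    have "exp (\<beta> * (x i - c)) \<le> (\<Sum>j\<in>I. exp (\<beta> * (x j - c)))"
      using \<open>finite I\<close> that by (intro member_le_sum) auto
    also have "\<dots> \<le> exp (\<Sum>j\<in>I. exp (\<beta> * (x j - c)))"
      using exp_ge_add_one_self[of "\<Sum>j\<in>I. exp (\<beta> * (x j - c))"] by linarith
    finally show ?thesis by (simp add: F_def exp_minus field_simps)
  qed
  have weight_le: "\<bar>exp (\<beta> * (x i - c)) * F x * y\<bar> \<le> \<bar>y\<bar>" if "i \<in> I" for x i y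
    using eF[OF that, of x] Fpos(1)[of x] by (simp add: abs_mult mult_left_le_one_le)
  have hG: "\<bar>h \<theta> \<omega>\<bar> \<le> G \<omega>" for \<theta> \<omega>
  proof -
    have "\<bar>exp (\<beta> * (X \<theta> i \<omega> - c)) * F (\<lambda>j. X \<theta> j \<omega>) * X' \<theta> i \<omega>\<bar> \<le> \<bar>Y i (fst \<omega>)\<bar> + \<bar>Z i (snd \<omega>)\<bar>" if "i \<in> I" for i
    proof -
      have "\<bar>exp (\<beta> * (X \<theta> i \<omega> - c)) * F (\<lambda>j. X \<theta> j \<omega>) * X' \<theta> i \<omega>\<bar> \<le> \<bar>X' \<theta> i \<omega>\<bar>"
        using weight_le[OF that, of "\<lambda>j. X \<theta> j \<omega>"] .
      also have "\<dots> \<le> \<bar>sin \<theta>\<bar> * \<bar>Y i (fst \<omega>)\<bar> + \<bar>cos \<theta>\<bar> * \<bar>Z i (snd \<omega>)\<bar>"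
        unfolding X'_def by (rule order_trans[OF abs_triangle_ineq]) (simp add: abs_mult)
      also have "\<dots> \<le> \<bar>Y i (fst \<omega>)\<bar> + \<bar>Z i (snd \<omega>)\<bar>"
        by (intro add_mono mult_left_le_one_le) auto
      finally show ?thesis .
    qed
    then have "\<bar>\<Sum>i\<in>I. exp (\<beta> * (X \<theta> i \<omega> - c)) * F (\<lambda>j. X \<theta> j \<omega>) * X' \<theta> i \<omega>\<bar> \<le> (\<Sum>i\<in>I. \<bar>Y i (fst \<omega>)\<bar> + \<bar>Z i (snd \<omega>)\<bar>)"
      by (intro order_trans[OF sum_abs] sum_mono)
    then show ?thesis using \<open>\<beta> > 0\<close> by (simp add: h_def G_def abs_mult)
  qed
  have h_m: "(\<lambda>(\<omega>, \<theta>). h \<theta> \<omega>) \<in> borel_measurable ((M \<Otimes>\<^sub>M P) \<Otimes>\<^sub>M lborel)"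
    unfolding h_def F_def X_def X'_def by measurable
  note [measurable] = h_m
  have h_int: "integrable ((M \<Otimes>\<^sub>M P) \<Otimes>\<^sub>M lborel) (\<lambda>(\<omega>, \<theta>). h \<theta> \<omega> * indicator {0..pi/2} \<theta>)"
  proof (rule Q.Fubini_integrable)
    have slice: "integrable lborel (\<lambda>\<theta>. h \<theta> \<omega> * indicator {0..pi/2} \<theta>)" if "\<omega> \<in> space (M \<Otimes>\<^sub>M P)" for \<omega>
    proof (rule Bochner_Integration.integrable_bound)
      show "integrable lborel (\<lambda>\<theta>. G \<omega> * indicator {0..pi/2} \<theta>)" by simp
      show "(\<lambda>\<theta>. h \<theta> \<omega> * indicator {0..pi/2} \<theta>) \<in> borel_measurable lborel"
        using measurable_Pair2[OF h_m that] by simp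
      show "AE \<theta> in lborel. norm (h \<theta> \<omega> * indicator {0..pi/2} \<theta>) \<le> norm (G \<omega> * indicator {0..pi/2} \<theta>)"
        using order_trans[OF hG abs_ge_self] by (intro AE_I2) (simp add: indicator_def)
    qed
    then show "AE \<omega> in M \<Otimes>\<^sub>M P. integrable lborel (\<lambda>\<theta>. case (\<omega>, \<theta>) of (\<omega>, \<theta>) \<Rightarrow> h \<theta> \<omega> * indicator {0..pi/2} \<theta>)"
      by (auto intro!: AE_I2)
    show "integrable (M \<Otimes>\<^sub>M P) (\<lambda>\<omega>. \<integral>\<theta>. norm (case (\<omega>, \<theta>) of (\<omega>, \<theta>) \<Rightarrow> h \<theta> \<omega> * indicator {0..pi/2} \<theta>) \<partial>lborel)"
    proof (rule Bochner_Integration.integrable_bound)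
      show "integrable (M \<Otimes>\<^sub>M P) (\<lambda>\<omega>. G \<omega> * (pi / 2))" using intG by simp
      show "AE \<omega> in M \<Otimes>\<^sub>M P. norm (\<integral>\<theta>. norm (case (\<omega>, \<theta>) of (\<omega>, \<theta>) \<Rightarrow> h \<theta> \<omega> * indicator {0..pi/2} \<theta>) \<partial>lborel) \<le> norm (G \<omega> * (pi / 2))"
      proof (rule AE_I2)
        fix \<omega> assume \<omega>: "\<omega> \<in> space (M \<Otimes>\<^sub>M P)"
        have "(\<integral>\<theta>. norm (h \<theta> \<omega> * indicator {0..pi/2} \<theta>) \<partial>lborel) \<le> (\<integral>\<theta>. G \<omega> * indicator {0..pi/2} \<theta> \<partial>lborel)"
        proof (rule integral_mono[OF integrable_norm[OF slice[OF \<omega>]]])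
          show "integrable lborel (\<lambda>\<theta>. G \<omega> * indicator {0..pi/2} \<theta>)" by simp
          show "norm (h \<theta> \<omega> * indicator {0..pi/2} \<theta>) \<le> G \<omega> * indicator {0..pi/2} \<theta>" for \<theta>
            using hG[of \<theta> \<omega>] by (simp add: indicator_def)
        qed
        also have "\<dots> = G \<omega> * (pi / 2)" by simp
        finally show "norm (\<integral>\<theta>. norm (case (\<omega>, \<theta>) of (\<omega>, \<theta>) \<Rightarrow> h \<theta> \<omega> * indicator {0..pi/2} \<theta>) \<partial>lborel) \<le> norm (G \<omega> * (pi / 2))"
          by simp
      qed
    qed measurable
  qed measurable
  have ftc: "(\<integral>\<theta>. h \<theta> \<omega> * indicator {0..pi/2} \<theta> \<partial>lborel) = F (\<lambda>j. Z j (snd \<omega>)) - F (\<lambda>j. Y j (fst \<omega>))" for \<omega>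
  proof -
    have "(\<integral>\<theta>. h \<theta> \<omega> * indicator {0..pi/2} \<theta> \<partial>lborel) = F (\<lambda>j. X (pi/2) j \<omega>) - F (\<lambda>j. X 0 j \<omega>)"
    proof (rule integral_FTC_Icc_real[where F = "\<lambda>\<theta>. F (\<lambda>j. X \<theta> j \<omega>)"])
      fix \<theta>
      have D: "((\<lambda>\<theta>. X \<theta> j \<omega>) has_real_derivative X' \<theta> j \<omega>) (at \<theta>)" for j
        unfolding X_def X'_def by (auto intro!: derivative_eq_intros)
      show "((\<lambda>\<theta>. F (\<lambda>j. X \<theta> j \<omega>)) has_real_derivative h \<theta> \<omega>) (at \<theta>)"
        unfolding F_def h_def
        by (auto intro!: derivative_eq_intros D simp: sum_distrib_left sum_distrib_right sum_negf mult_ac)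
      show "isCont (\<lambda>\<theta>. h \<theta> \<omega>) \<theta>"
        unfolding h_def F_def X_def X'_def by (intro continuous_intros)
    qed simp
    then show ?thesis by (simp add: X_def)
  qed
  have nonneg: "0 \<le> (\<integral>\<omega>. h \<theta> \<omega> * indicator {0..pi/2} \<theta> \<partial>(M \<Otimes>\<^sub>M P))" for \<theta>
  proof (cases "\<theta> \<in> {0..pi/2}")
    case True
    have X_m: "X \<theta> i \<in> borel_measurable (M \<Otimes>\<^sub>M P)" "X' \<theta> i \<in> borel_measurable (M \<Otimes>\<^sub>M P)" if "i \<in> I" for i
      using that unfolding X_def X'_def by measurable
    have "(\<integral>\<omega>. h \<theta> \<omega> \<partial>(M \<Otimes>\<^sub>M P))
        = - \<beta> * (\<Sum>i\<in>I. \<integral>\<omega>. exp (\<beta> * (X \<theta> i \<omega> - c)) * F (\<lambda>j. X \<theta> j \<omega>) * X' \<theta> i \<omega> \<partial>(M \<Otimes>\<^sub>M P))"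
      unfolding h_def
    proof (subst Bochner_Integration.integral_sum[symmetric])
      fix i assume i: "i \<in> I"
      have X'int: "integrable (M \<Otimes>\<^sub>M P) (X' \<theta> i)"
        unfolding X'_def using int i
        by (intro Bochner_Integration.integrable_add integrable_mult_right MP.integrable_comp_fst MP.integrable_comp_snd) auto
      show "integrable (M \<Otimes>\<^sub>M P) (\<lambda>\<omega>. exp (\<beta> * (X \<theta> i \<omega> - c)) * F (\<lambda>j. X \<theta> j \<omega>) * X' \<theta> i \<omega>)"
      proof (rule Bochner_Integration.integrable_bound[OF X'int])
        show "(\<lambda>\<omega>. exp (\<beta> * (X \<theta> i \<omega> - c)) * F (\<lambda>j. X \<theta> j \<omega>) * X' \<theta> i \<omega>) \<in> borel_measurable (M \<Otimes>\<^sub>M P)"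
          using X_m i unfolding F_def by measurable
        show "AE \<omega> in M \<Otimes>\<^sub>M P. norm (exp (\<beta> * (X \<theta> i \<omega> - c)) * F (\<lambda>j. X \<theta> j \<omega>) * X' \<theta> i \<omega>) \<le> norm (X' \<theta> i \<omega>)"
          using weight_le[OF i, of "\<lambda>j. X \<theta> j \<omega>" for \<omega>] by (intro AE_I2) (simp only: real_norm_def)
      qed
    qed simp
    moreover have "(\<Sum>i\<in>I. \<integral>\<omega>. exp (\<beta> * (X \<theta> i \<omega> - c)) * F (\<lambda>j. X \<theta> j \<omega>) * X' \<theta> i \<omega> \<partial>(M \<Otimes>\<^sub>M P)) \<le> 0"
      using gaussian_interpolation_drift_nonpos[OF assms(1-3) _ Y Z diag le _ _ \<open>\<beta> > 0\<close>, of _ \<theta> c] True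
      unfolding X_def X'_def F_def by (intro sum_nonpos) auto
    ultimately show ?thesis
      using True \<open>\<beta> > 0\<close> by (simp add: mult_nonneg_nonpos)
  qed simp
  have bF: "integrable M (\<lambda>\<omega>. F (\<lambda>j. Y j \<omega>))" "integrable P (\<lambda>\<omega>. F (\<lambda>j. Z j \<omega>))"
    using Fpos unfolding less_le F_def
    by (auto intro!: M.integrable_const_bound[of _ 1] P.integrable_const_bound[of _ 1])
  have "0 \<le> (\<integral>\<theta>. (\<integral>\<omega>. h \<theta> \<omega> * indicator {0..pi/2} \<theta> \<partial>(M \<Otimes>\<^sub>M P)) \<partial>lborel)"
    using nonneg by (rule Bochner_Integration.integral_nonneg)
  also have "\<dots> = (\<integral>\<omega>. (\<integral>\<theta>. h \<theta> \<omega> * indicator {0..pi/2} \<theta> \<partial>lborel) \<partial>(M \<Otimes>\<^sub>M P))"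
    by (rule Q.Fubini_integral[OF h_int])
  also have "\<dots> = (\<integral>\<omega>. F (\<lambda>j. Z j (snd \<omega>)) - F (\<lambda>j. Y j (fst \<omega>)) \<partial>(M \<Otimes>\<^sub>M P))"
    by (simp only: ftc)
  also have "\<dots> = (\<integral>\<omega>. F (\<lambda>j. Z j (snd \<omega>)) \<partial>(M \<Otimes>\<^sub>M P)) - (\<integral>\<omega>. F (\<lambda>j. Y j (fst \<omega>)) \<partial>(M \<Otimes>\<^sub>M P))"
    using bF by (intro Bochner_Integration.integral_diff MP.integrable_comp_fst MP.integrable_comp_snd) auto
  also have "(\<integral>\<omega>. F (\<lambda>j. Z j (snd \<omega>)) \<partial>(M \<Otimes>\<^sub>M P)) = (\<integral>\<omega>. F (\<lambda>j. Z j \<omega>) \<partial>P)"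
    using MP.integral_fst'[OF MP.integrable_comp_snd[OF bF(2)]] by (simp add: M.prob_space)
  also have "(\<integral>\<omega>. F (\<lambda>j. Y j (fst \<omega>)) \<partial>(M \<Otimes>\<^sub>M P)) = (\<integral>\<omega>. F (\<lambda>j. Y j \<omega>) \<partial>M)"
    using MP.integral_fst'[OF MP.integrable_comp_fst[OF bF(1)]] by (simp add: P.prob_space)
  finally show ?thesis by (simp add: F_def)
qed

text \<open>As \<open>\<beta>\<close> grows, \<open>F \<beta> c\<close> tends to 1 on \<open>max < c\<close> and to 0 on \<open>max > c\<close>. This gives the
  inequality with a gap \<open>2 s\<close> between the two levels; continuity of measure closes the gap.\<close>
theorem slepian_inequality:
  fixes Y :: "'i \<Rightarrow> 'a \<Rightarrow> real" and Z :: "'i \<Rightarrow> 'b \<Rightarrow> real"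
  assumes "prob_space M" "prob_space P" "finite I"
    and Y: "gaussian_vector M I Y R" and Z: "gaussian_vector P I Z C"
    and diag: "\<And>i. i \<in> I \<Longrightarrow> R i i = 1" "\<And>i. i \<in> I \<Longrightarrow> C i i = 1"
    and le: "\<And>i j. i \<in> I \<Longrightarrow> j \<in> I \<Longrightarrow> R i j \<le> C i j"
  shows "measure M {\<omega> \<in> space M. \<forall>i\<in>I. Y i \<omega> \<le> x} \<le> measure P {\<omega> \<in> space P. \<forall>i\<in>I. Z i \<omega> \<le> x}"
proof -
  interpret M: prob_space M by fact
  interpret P: prob_space P by fact
  define A where "A = (\<lambda>x. {\<omega> \<in> space M. \<forall>i\<in>I. Y i \<omega> \<le> x})"
  define B where "B = (\<lambda>x. {\<omega> \<in> space P. \<forall>i\<in>I. Z i \<omega> \<le> x})"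
  have [measurable]: "Y j \<in> borel_measurable M" "Z j \<in> borel_measurable P" if "j \<in> I" for j
    using Y Z that by (auto simp: gaussian_vector_def)
  have Am [measurable]: "A x \<in> sets M" and Bm [measurable]: "B x \<in> sets P" for x
    unfolding A_def B_def using \<open>finite I\<close> by measurable
  have [simp]: "integrable M (\<lambda>\<omega>. indicator (A x) \<omega> :: real)" "integrable P (\<lambda>\<omega>. indicator (B x) \<omega> :: real)" for x
    by (auto intro!: M.integrable_const_bound[of _ 1] P.integrable_const_bound[of _ 1] simp: indicator_def)
  define F where "F = (\<lambda>\<beta> c (x :: 'i \<Rightarrow> real). exp (- (\<Sum>j\<in>I. exp (\<beta> * (x j - c)))))"
  have F01: "0 \<le> F \<beta> c x" "F \<beta> c x \<le> 1" for \<beta> c x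
    unfolding F_def by (auto intro!: sum_nonneg)
  have Fint: "integrable M (\<lambda>\<omega>. F \<beta> c (\<lambda>j. Y j \<omega>))" "integrable P (\<lambda>\<omega>. F \<beta> c (\<lambda>j. Z j \<omega>))" for \<beta> c
    using F01 unfolding F_def
    by (auto intro!: M.integrable_const_bound[of _ 1] P.integrable_const_bound[of _ 1])
  have fuzzy: "measure M (A (c - s)) \<le> measure P (B (c + s))" if "s > 0" for c s
  proof -
    have bound: "exp (- (card I * exp (- \<beta> * s))) * measure M (A (c - s)) \<le> measure P (B (c + s)) + exp (- exp (\<beta> * s))"
      if "\<beta> > 0" for \<beta>
    proof -
      have "exp (- (card I * exp (- \<beta> * s))) * measure M (A (c - s))
          = (\<integral>\<omega>. exp (- (card I * exp (- \<beta> * s))) * indicator (A (c - s)) \<omega> \<partial>M)"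
        using Am[of "c - s"] by (simp add: sets.Int_space_eq2)
      also have "\<dots> \<le> (\<integral>\<omega>. F \<beta> c (\<lambda>j. Y j \<omega>) \<partial>M)"
      proof (rule integral_mono[OF _ Fint(1)])
        fix \<omega>
        show "exp (- (card I * exp (- \<beta> * s))) * indicator (A (c - s)) \<omega> \<le> F \<beta> c (\<lambda>j. Y j \<omega>)"
        proof (cases "\<omega> \<in> A (c - s)")
          case True
          have "(\<Sum>j\<in>I. exp (\<beta> * (Y j \<omega> - c))) \<le> (\<Sum>j\<in>I. exp (- \<beta> * s))"
          proof (rule sum_mono)
            fix j assume "j \<in> I"
            then have "\<beta> * (Y j \<omega> - c) \<le> \<beta> * (- s)"
              using True \<open>\<beta> > 0\<close> by (intro mult_left_mono) (auto simp: A_def algebra_simps)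
            then show "exp (\<beta> * (Y j \<omega> - c)) \<le> exp (- \<beta> * s)" by simp
          qed
          then show ?thesis using True by (simp add: F_def)
        qed (simp add: F01)
      qed simp
      also have "\<dots> \<le> (\<integral>\<omega>. F \<beta> c (\<lambda>j. Z j \<omega>) \<partial>P)"
        unfolding F_def by (rule gaussian_comparison_exp_sum[OF assms(1-3) Y Z diag le \<open>\<beta> > 0\<close>])
      also have "\<dots> \<le> (\<integral>\<omega>. indicator (B (c + s)) \<omega> + exp (- exp (\<beta> * s)) \<partial>P)"
      proof (rule integral_mono[OF Fint(2)])
        fix \<omega> assume "\<omega> \<in> space P"
        show "F \<beta> c (\<lambda>j. Z j \<omega>) \<le> indicator (B (c + s)) \<omega> + exp (- exp (\<beta> * s))"
        proof (cases "\<omega> \<in> B (c + s)")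
          case False
          then obtain j where j: "j \<in> I" "Z j \<omega> > c + s"
            using \<open>\<omega> \<in> space P\<close> by (auto simp: B_def not_le)
          have "exp (\<beta> * s) \<le> exp (\<beta> * (Z j \<omega> - c))"
            using j \<open>\<beta> > 0\<close> by simp
          also have "\<dots> \<le> (\<Sum>j\<in>I. exp (\<beta> * (Z j \<omega> - c)))"
            using \<open>finite I\<close> j by (intro member_le_sum) auto
          finally show ?thesis using False by (simp add: F_def)
        next
          case True
          then show ?thesis using F01(2)[of \<beta> c "\<lambda>j. Z j \<omega>"] by (simp add: add_increasing2)
        qed
      qed simp
      also have "\<dots> = measure P (B (c + s)) + exp (- exp (\<beta> * s))"
        by (simp add: P.prob_space)
      finally show ?thesis .
    qed
    have "((\<lambda>\<beta>. exp (- \<beta> * s)) \<longlongrightarrow> 0) at_top"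
      using \<open>s > 0\<close> by real_asymp
    then have "((\<lambda>\<beta>. exp (- (card I * exp (- \<beta> * s))) * measure M (A (c - s))) \<longlongrightarrow> exp (- (real (card I) * 0)) * measure M (A (c - s))) at_top"
      by (intro tendsto_intros)
    moreover have "((\<lambda>\<beta>. exp (- exp (\<beta> * s))) \<longlongrightarrow> 0) at_top"
      using \<open>s > 0\<close> by real_asymp
    then have "((\<lambda>\<beta>. measure P (B (c + s)) + exp (- exp (\<beta> * s))) \<longlongrightarrow> measure P (B (c + s)) + 0) at_top"
      by (intro tendsto_intros)
    moreover have "\<forall>\<^sub>F \<beta> in at_top. exp (- (card I * exp (- \<beta> * s))) * measure M (A (c - s)) \<le> measure P (B (c + s)) + exp (- exp (\<beta> * s))"
      using eventually_gt_at_top[of 0] by eventually_elim (rule bound)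
    ultimately have "exp (- (real (card I) * 0)) * measure M (A (c - s)) \<le> measure P (B (c + s)) + 0"
      by (intro tendsto_le[OF trivial_limit_at_top_linorder])
    then show ?thesis by simp
  qed
  have "(\<lambda>n. measure P (B (x + inverse (real (Suc n))))) \<longlonglongrightarrow> measure P (\<Inter>n. B (x + inverse (real (Suc n))))"
  proof (rule P.finite_Lim_measure_decseq)
    show "decseq (\<lambda>n. B (x + inverse (real (Suc n))))"
      unfolding decseq_def B_def
      by (auto intro: order_trans simp: le_imp_inverse_le)
  qed auto
  moreover have "(\<Inter>n. B (x + inverse (real (Suc n)))) = B x"
  proof (intro equalityI subsetI)
    fix \<omega> assume *: "\<omega> \<in> (\<Inter>n. B (x + inverse (real (Suc n))))"
    then have "\<omega> \<in> space P" by (auto simp: B_def)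
    moreover have "Z i \<omega> \<le> x" if "i \<in> I" for i
    proof (rule LIMSEQ_le_const)
      show "(\<lambda>n. x + inverse (real (Suc n))) \<longlonglongrightarrow> x"
        by (rule LIMSEQ_inverse_real_of_nat_add)
    qed (use * that in \<open>auto simp: B_def\<close>)
    ultimately show "\<omega> \<in> B x" by (auto simp: B_def)
  qed (auto simp: B_def intro: order_trans)
  moreover have "measure M (A x) \<le> measure P (B (x + inverse (real (Suc n))))" for n
    using fuzzy[of "inverse (real (Suc n)) / 2" "x + inverse (real (Suc n)) / 2"]
    by (simp only: add.assoc field_sum_of_halves add_diff_cancel_right') simp
  ultimately have "measure M (A x) \<le> measure P (B x)"
    by (intro LIMSEQ_le_const) auto
  then show ?thesis by (simp add: A_def B_def)
qed

section \<open>Equicorrelated standard normal variables\<close>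

abbreviation iid_normal :: "'i set \<Rightarrow> ('i \<Rightarrow> real) measure" where
  "iid_normal J \<equiv> PiM J (\<lambda>_. std_normal_distribution)"

lemma prob_space_std_normal: "prob_space std_normal_distribution"
  using real_dist_normal_dist by (simp add: real_distribution_def)

lemma product_prob_space_std_normal: "product_prob_space (\<lambda>_. std_normal_distribution)"
  using prob_space_std_normal
  by (simp add: product_prob_space_def product_prob_space_axioms_def product_sigma_finite_def prob_space_imp_sigma_finite)

lemma integrable_std_normal_id: "integrable std_normal_distribution (\<lambda>x. x)"
  using integrable_std_normal_distribution_moment[of 1] by simp

lemma iid_normal_char:
  assumes "finite J"
  shows "(CLINT z|iid_normal J. iexp (\<Sum>i\<in>J. b i * z i)) = exp (- (\<Sum>i\<in>J. (b i)\<^sup>2) / 2)"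
proof -
  interpret N: prob_space std_normal_distribution by (rule prob_space_std_normal)
  interpret S: product_prob_space "\<lambda>_. std_normal_distribution" J by (rule product_prob_space_std_normal)
  have "(CLINT z|iid_normal J. iexp (\<Sum>i\<in>J. b i * z i)) = (CLINT z|iid_normal J. \<Prod>i\<in>J. iexp (b i * z i))"
    using assms by (simp add: exp_sum sum_distrib_left)
  also have "\<dots> = (\<Prod>i\<in>J. char std_normal_distribution (b i))"
    unfolding char_def using assms
    by (intro S.product_integral_prod) (auto intro!: N.integrable_const_bound[of _ 1])
  also have "\<dots> = exp (\<Sum>i\<in>J. - (b i)\<^sup>2 / 2)"
    using assms by (simp add: char_std_normal_distribution exp_sum)
  also have "(\<Sum>i\<in>J. - (b i)\<^sup>2 / 2) = - (\<Sum>i\<in>J. (b i)\<^sup>2) / 2"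
    by (simp add: sum_negf sum_divide_distrib)
  finally show ?thesis .
qed

lemma gaussian_vector_equicorrelated:
  fixes t :: real
  assumes "finite J" and t: "0 \<le> t" "t \<le> 1"
  shows "gaussian_vector (std_normal_distribution \<Otimes>\<^sub>M iid_normal J) J
    (\<lambda>i \<omega>. sqrt (1 - t) * snd \<omega> i + sqrt t * fst \<omega>) (\<lambda>i j. if i = j then 1 else t)"
proof -
  interpret N: prob_space std_normal_distribution by (rule prob_space_std_normal)
  interpret S: product_prob_space "\<lambda>_. std_normal_distribution" J by (rule product_prob_space_std_normal)
  interpret J: prob_space "iid_normal J" by (intro prob_space_PiM prob_space_std_normal)
  interpret NJ: pair_prob_space std_normal_distribution "iid_normal J" ..
  show ?thesis unfolding gaussian_vector_def
  proof (intro conjI ballI allI)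
    fix i assume "i \<in> J"
    have "integrable (iid_normal J) (\<lambda>z. z i)"
    proof (rule integrable_distr)
      show "integrable (distr (iid_normal J) std_normal_distribution (\<lambda>z. z i)) (\<lambda>x. x)"
        using S.PiM_component[of i] \<open>i \<in> J\<close> integrable_std_normal_id by simp
    qed (use \<open>i \<in> J\<close> in measurable)
    then show "integrable (std_normal_distribution \<Otimes>\<^sub>M iid_normal J) (\<lambda>\<omega>. sqrt (1 - t) * snd \<omega> i + sqrt t * fst \<omega>)"
      by (intro Bochner_Integration.integrable_add integrable_mult_right NJ.integrable_comp_fst integrable_std_normal_id
            NJ.integrable_comp_snd[of "\<lambda>z. z i"])
  next
    fix a :: "_ \<Rightarrow> real"
    have "(\<Sum>i\<in>J. a i * (sqrt (1 - t) * snd \<omega> i + sqrt t * fst \<omega>))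
        = sqrt t * (\<Sum>i\<in>J. a i) * fst \<omega> + (\<Sum>i\<in>J. (sqrt (1 - t) * a i) * snd \<omega> i)" for \<omega> :: "real \<times> _"
      by (simp add: sum.distrib sum_distrib_left sum_distrib_right algebra_simps)
    then have "(CLINT \<omega>|std_normal_distribution \<Otimes>\<^sub>M iid_normal J. iexp (\<Sum>i\<in>J. a i * (sqrt (1 - t) * snd \<omega> i + sqrt t * fst \<omega>)))
       = (CLINT \<omega>|std_normal_distribution \<Otimes>\<^sub>M iid_normal J.
            iexp (sqrt t * (\<Sum>i\<in>J. a i) * fst \<omega> + (\<Sum>i\<in>J. (sqrt (1 - t) * a i) * snd \<omega> i)))"
      by (simp only:)
    also have "\<dots> = char std_normal_distribution (sqrt t * (\<Sum>i\<in>J. a i))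
        * (CLINT z|iid_normal J. iexp (\<Sum>i\<in>J. (sqrt (1 - t) * a i) * z i))"
      unfolding char_def by (intro NJ.integral_prod_iexp) measurable
    also have "\<dots> = exp (- (sqrt t * (\<Sum>i\<in>J. a i))\<^sup>2 / 2 + - (\<Sum>i\<in>J. (sqrt (1 - t) * a i)\<^sup>2) / 2)"
      unfolding iid_normal_char[OF \<open>finite J\<close>] char_std_normal_distribution by (simp only: exp_add of_real_mult)
    also have "(\<Sum>i\<in>J. (sqrt (1 - t) * a i)\<^sup>2) = (1 - t) * (\<Sum>i\<in>J. (a i)\<^sup>2)"
      using t by (simp add: power_mult_distrib sum_distrib_left)
    also have "(sqrt t * (\<Sum>i\<in>J. a i))\<^sup>2 = t * (\<Sum>i\<in>J. \<Sum>j\<in>J. a i * a j)"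
      by (simp only: power_mult_distrib real_sqrt_pow2[OF t(1)] power2_eq_square[of "sum a J"] sum_product)
    also have "- (t * (\<Sum>i\<in>J. \<Sum>j\<in>J. a i * a j)) / 2 + - ((1 - t) * (\<Sum>i\<in>J. (a i)\<^sup>2)) / 2
       = - (\<Sum>i\<in>J. \<Sum>j\<in>J. a i * a j * (if i = j then 1 else t)) / 2"
    proof -
      have "(\<Sum>i\<in>J. \<Sum>j\<in>J. a i * a j * (if i = j then 1 else t))
          = (\<Sum>i\<in>J. \<Sum>j\<in>J. t * (a i * a j)) + (\<Sum>i\<in>J. \<Sum>j\<in>J. if j = i then (1 - t) * (a i)\<^sup>2 else 0)"
        unfolding sum.distrib[symmetric]
        by (intro sum.cong refl) (auto simp: algebra_simps power2_eq_square)
      also have "(\<Sum>i\<in>J. \<Sum>j\<in>J. if j = i then (1 - t) * (a i)\<^sup>2 else 0) = (\<Sum>i\<in>J. (1 - t) * (a i)\<^sup>2)"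
        using \<open>finite J\<close> by (intro sum.cong refl) simp
      finally show ?thesis by (simp add: sum_distrib_left[symmetric] add_divide_distrib)
    qed
    finally show "(CLINT \<omega>|std_normal_distribution \<Otimes>\<^sub>M iid_normal J. iexp (\<Sum>i\<in>J. a i * (sqrt (1 - t) * snd \<omega> i + sqrt t * fst \<omega>)))
       = exp (- (\<Sum>i\<in>J. \<Sum>j\<in>J. a i * a j * (if i = j then 1 else t)) / 2)" .
  qed auto
qed

text \<open>If all variables are at most \<open>x\<close> and the common component exceeds \<open>- s\<close>, then every
  independent component is at most \<open>(x + sqrt t * s) / sqrt (1 - t)\<close>.\<close>
lemma prob_equicorrelated_le:
  fixes t :: real
  assumes "finite J" and t: "0 < t" "t < 1"
  shows "measure (std_normal_distribution \<Otimes>\<^sub>M iid_normal J)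
      {\<omega> \<in> space (std_normal_distribution \<Otimes>\<^sub>M iid_normal J). \<forall>i\<in>J. sqrt (1 - t) * snd \<omega> i + sqrt t * fst \<omega> \<le> x}
    \<le> std_normal_cdf (- s) + std_normal_cdf ((x + sqrt t * s) / sqrt (1 - t)) ^ card J"
proof -
  interpret N: prob_space std_normal_distribution by (rule prob_space_std_normal)
  interpret S: product_prob_space "\<lambda>_. std_normal_distribution" J by (rule product_prob_space_std_normal)
  interpret J: prob_space "iid_normal J" by (intro prob_space_PiM prob_space_std_normal)
  interpret NJ: pair_prob_space std_normal_distribution "iid_normal J" ..
  define y where "y = (x + sqrt t * s) / sqrt (1 - t)"
  let ?N = std_normal_distribution
  define A where "A = {..- s} \<times> space (iid_normal J)"
  define B where "B = (UNIV :: real set) \<times> (\<Pi>\<^sub>E i\<in>J. {..y})"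
  have Am: "A \<in> sets (?N \<Otimes>\<^sub>M iid_normal J)"
    unfolding A_def by (intro pair_measureI) auto
  have PiE_m: "(\<Pi>\<^sub>E i\<in>J. {..y}) \<in> sets (iid_normal J)"
    using \<open>finite J\<close> by (intro sets_PiM_I_finite) auto
  then have Bm: "B \<in> sets (?N \<Otimes>\<^sub>M iid_normal J)"
    unfolding B_def by (intro pair_measureI) auto
  have times: "measure (?N \<Otimes>\<^sub>M iid_normal J) (D \<times> E) = measure ?N D * measure (iid_normal J) E"
    if "D \<in> sets ?N" "E \<in> sets (iid_normal J)" for D E
    using sigma_finite_measure.emeasure_pair_measure_Times[OF prob_space_imp_sigma_finite[OF S.P.prob_space_axioms] that] by (simp add: measure_def enn2real_mult)
  have "{\<omega> \<in> space (?N \<Otimes>\<^sub>M iid_normal J). \<forall>i\<in>J. sqrt (1 - t) * snd \<omega> i + sqrt t * fst \<omega> \<le> x} \<subseteq> A \<union> B"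
  proof safe
    fix z0 :: real and z
    assume sp: "(z0, z) \<in> space (?N \<Otimes>\<^sub>M iid_normal J)"
      and le: "\<forall>i\<in>J. sqrt (1 - t) * snd (z0, z) i + sqrt t * fst (z0, z) \<le> x" and "(z0, z) \<notin> B"
    then obtain i where i: "i \<in> J" "z i > y"
      by (auto simp: B_def space_pair_measure space_PiM PiE_def Pi_def not_le)
    have "x + sqrt t * s < sqrt (1 - t) * z i"
      using i(2) t by (simp add: y_def field_simps)
    then have "sqrt t * z0 < sqrt t * (- s)"
      using le i(1) by (auto simp: algebra_simps)
    then have "z0 < - s" using t by (subst (asm) mult_less_cancel_left_pos) auto
    then show "(z0, z) \<in> A" using sp by (auto simp: A_def space_pair_measure)
  qed
  then have "measure (?N \<Otimes>\<^sub>M iid_normal J) {\<omega> \<in> space (?N \<Otimes>\<^sub>M iid_normal J). \<forall>i\<in>J. sqrt (1 - t) * snd \<omega> i + sqrt t * fst \<omega> \<le> x}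
      \<le> measure (?N \<Otimes>\<^sub>M iid_normal J) (A \<union> B)"
    by (rule NJ.P.finite_measure_mono[OF _ sets.Un[OF Am Bm]])
  also have "\<dots> \<le> measure (?N \<Otimes>\<^sub>M iid_normal J) A + measure (?N \<Otimes>\<^sub>M iid_normal J) B"
    by (intro measure_Un_le Am Bm)
  also have "measure (?N \<Otimes>\<^sub>M iid_normal J) A = std_normal_cdf (- s)"
    unfolding A_def by (subst times) (auto simp: std_normal_cdf_def cdf_def S.P.prob_space)
  also have "measure (?N \<Otimes>\<^sub>M iid_normal J) B = measure (iid_normal J) (\<Pi>\<^sub>E i\<in>J. {..y})"
    unfolding B_def using PiE_m N.prob_space by (subst times) auto
  also have "\<dots> = (\<Prod>i\<in>J. measure ?N {..y})"
    using \<open>finite J\<close>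
    by (intro finite_product_prob_space.prob_times)
       (auto simp: finite_product_prob_space_def finite_product_sigma_finite_def finite_product_sigma_finite_axioms_def
          product_prob_space_std_normal S.product_sigma_finite_axioms)
  also have "\<dots> = std_normal_cdf y ^ card J"
    by (simp add: std_normal_cdf_def cdf_def)
  finally show ?thesis by (simp add: y_def)
qed

section \<open>Gaussian rows and their sparse subsets\<close>

lemma gaussian_vector_subset:
  fixes X :: "'i \<Rightarrow> 'a \<Rightarrow> real"
  assumes X: "gaussian_vector M I X R" and "finite I" "J \<subseteq> I"
  shows "gaussian_vector M J X R"
  unfolding gaussian_vector_def
proof (intro conjI ballI allI)
  fix a :: "'i \<Rightarrow> real"
  define b where "b = (\<lambda>i. if i \<in> J then a i else 0)"
  have restrict: "(\<Sum>i\<in>I. b i * f i) = (\<Sum>i\<in>J. a i * f i)" for f :: "'i \<Rightarrow> real"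
    using assms(2,3) by (intro sum.mono_neutral_cong_right) (auto simp: b_def)
  have "(\<Sum>i\<in>I. \<Sum>j\<in>I. b i * b j * R i j) = (\<Sum>i\<in>J. \<Sum>j\<in>J. a i * a j * R i j)"
    unfolding mult.assoc sum_distrib_left[symmetric] restrict ..
  moreover have "(CLINT \<omega>|M. iexp (\<Sum>i\<in>I. b i * X i \<omega>)) = exp (- (\<Sum>i\<in>I. \<Sum>j\<in>I. b i * b j * R i j) / 2)"
    using X by (simp only: gaussian_vector_def)
  ultimately show "(CLINT \<omega>|M. iexp (\<Sum>i\<in>J. a i * X i \<omega>)) = exp (- (\<Sum>i\<in>J. \<Sum>j\<in>J. a i * a j * R i j) / 2)"
    by (simp only: restrict)
qed (use assms in \<open>unfold gaussian_vector_def, blast+\<close>)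

text \<open>The case \<open>s = 0\<close> of a point mass has to be included, because a linear combination of the
  coordinates of a Gaussian vector may degenerate.\<close>
lemma (in prob_space) centred_normal_law_iexp:
  assumes [measurable]: "S \<in> borel_measurable M" and law: "distr M borel S = normal_law m s" and "0 \<le> s"
    and mean: "expectation S = 0"
  shows "expectation (\<lambda>\<omega>. iexp (S \<omega>)) = exp (- expectation (\<lambda>\<omega>. (S \<omega>)\<^sup>2) / 2)"
proof (cases "s = 0")
  case True
  have int: "expectation (\<lambda>\<omega>. g (S \<omega>)) = g m" if [measurable]: "g \<in> borel_measurable borel"
    for g :: "real \<Rightarrow> 'z :: {banach, second_countable_topology}"
    using True law integral_distr[of S M borel g] by (simp add: normal_law_def integral_return)
  have "m = 0" using int[of "\<lambda>x. x"] mean by simp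
  then show ?thesis using int[of iexp] int[of "\<lambda>x. x\<^sup>2"] by simp
next
  case False
  then have "s > 0" using \<open>0 \<le> s\<close> by simp
  have D: "distributed M lborel S (normal_density m s)"
    using law False distr_cong[OF refl sets_lborel, of M S S] by (simp add: distributed_def normal_law_def)
  have "m = 0" using normal_distributed_expectation[OF \<open>s > 0\<close> D] mean by simp
  have var: "expectation (\<lambda>\<omega>. (S \<omega>)\<^sup>2) = s\<^sup>2"
    using normal_distributed_variance[OF \<open>s > 0\<close> D] mean by simp
  have T: "distributed M lborel (\<lambda>\<omega>. S \<omega> / s) std_normal_density"
    using D normal_standard_normal_convert[OF \<open>s > 0\<close>, of S m] \<open>m = 0\<close> by simp
  have "expectation (\<lambda>\<omega>. iexp (S \<omega>)) = expectation (\<lambda>\<omega>. iexp (s * (S \<omega> / s)))"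
    using \<open>s > 0\<close> by simp
  also have "\<dots> = (CLINT x|distr M lborel (\<lambda>\<omega>. S \<omega> / s). iexp (s * x))"
    by (subst integral_distr) auto
  also have "\<dots> = char std_normal_distribution s"
    unfolding char_def distributed_distr_eq_density[OF T] ..
  finally show ?thesis by (simp add: char_std_normal_distribution var)
qed

lemma jointly_gaussian_imp_gaussian_vector:
  fixes X :: "'i \<Rightarrow> 'a \<Rightarrow> real"
  assumes "prob_space M" "finite I" and X: "jointly_gaussian M I X"
    and std: "\<And>i. i \<in> I \<Longrightarrow> distr M borel (X i) = std_normal_distribution"
  shows "gaussian_vector M I X (\<lambda>i j. covariance M (X i) (X j))"
    and "\<And>i. i \<in> I \<Longrightarrow> covariance M (X i) (X i) = 1"
proof -
  interpret prob_space M by fact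
  have Xm: "X i \<in> borel_measurable M" if "i \<in> I" for i using X that by (auto simp: jointly_gaussian_def)
  have moment: "integrable M (\<lambda>\<omega>. X i \<omega> ^ k)"
    "expectation (\<lambda>\<omega>. X i \<omega> ^ k) = (\<integral>x. x ^ k \<partial>std_normal_distribution)" if "i \<in> I" for i k
    using integrable_distr_eq[OF Xm[OF that], of "\<lambda>x. x ^ k"] integral_distr[OF Xm[OF that], of "\<lambda>x. x ^ k"]
      integrable_std_normal_distribution_moment[of k]
    by (simp_all add: std[OF that])
  have int: "integrable M (X i)" and mean: "expectation (X i) = 0" and sq: "integrable M (\<lambda>\<omega>. (X i \<omega>)\<^sup>2)"
    and var: "expectation (\<lambda>\<omega>. (X i \<omega>)\<^sup>2) = 1" if "i \<in> I" for i
    using moment[OF that, of 1] moment[OF that, of 2] integral_std_normal_distribution_moment_odd[of 1]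
      std_normal_distribution_even_moments(1)[of 1] by auto
  have cov: "covariance M (X i) (X j) = expectation (\<lambda>\<omega>. X i \<omega> * X j \<omega>)" if "i \<in> I" "j \<in> I" for i j
    using mean that by (simp add: covariance_def)
  have intp: "integrable M (\<lambda>\<omega>. X i \<omega> * X j \<omega>)" if "i \<in> I" "j \<in> I" for i j
  proof (rule Bochner_Integration.integrable_bound)
    show "integrable M (\<lambda>\<omega>. (X i \<omega>)\<^sup>2 + (X j \<omega>)\<^sup>2)" using sq that by simp
    show "(\<lambda>\<omega>. X i \<omega> * X j \<omega>) \<in> borel_measurable M" using Xm that by auto
    have "\<bar>x * y\<bar> \<le> x\<^sup>2 + y\<^sup>2" for x y :: real
    proof -
      have "0 \<le> \<bar>x\<bar> * \<bar>y\<bar>" by simp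
      then show ?thesis
        using sum_squares_bound[of "\<bar>x\<bar>" "\<bar>y\<bar>"] unfolding abs_mult power2_abs by linarith
    qed
    then show "AE \<omega> in M. norm (X i \<omega> * X j \<omega>) \<le> norm ((X i \<omega>)\<^sup>2 + (X j \<omega>)\<^sup>2)" by (intro AE_I2) simp
  qed
  show "covariance M (X i) (X i) = 1" if "i \<in> I" for i
    using cov[OF that that] var[OF that] by (simp add: power2_eq_square)
  show "gaussian_vector M I X (\<lambda>i j. covariance M (X i) (X j))"
    unfolding gaussian_vector_def
  proof (intro conjI ballI allI)
    fix a :: "'i \<Rightarrow> real"
    define S where "S = (\<lambda>\<omega>. \<Sum>i\<in>I. a i * X i \<omega>)"
    have "gaussian_rv M S" using X by (simp add: jointly_gaussian_def S_def)
    then obtain m s where S: "S \<in> borel_measurable M" "distr M borel S = normal_law m s" "0 \<le> s"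
      by (auto simp: gaussian_rv_def)
    have "expectation S = (\<Sum>i\<in>I. a i * expectation (X i))"
      unfolding S_def using int by (subst Bochner_Integration.integral_sum) auto
    then have "expectation S = 0" using mean by simp
    have "expectation (\<lambda>\<omega>. (S \<omega>)\<^sup>2) = expectation (\<lambda>\<omega>. \<Sum>i\<in>I. \<Sum>j\<in>I. a i * a j * (X i \<omega> * X j \<omega>))"
      by (simp add: S_def power2_eq_square sum_product mult_ac)
    also have "\<dots> = (\<Sum>i\<in>I. \<Sum>j\<in>I. expectation (\<lambda>\<omega>. a i * a j * (X i \<omega> * X j \<omega>)))"
      using intp by (subst Bochner_Integration.integral_sum; (intro Bochner_Integration.integrable_sum sum.cong refl)?)
        (auto intro!: Bochner_Integration.integral_sum)
    also have "\<dots> = (\<Sum>i\<in>I. \<Sum>j\<in>I. a i * a j * covariance M (X i) (X j))"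
      by (intro sum.cong refl) (simp add: cov)
    finally have "expectation (\<lambda>\<omega>. (S \<omega>)\<^sup>2) = (\<Sum>i\<in>I. \<Sum>j\<in>I. a i * a j * covariance M (X i) (X j))" .
    with centred_normal_law_iexp[OF S \<open>expectation S = 0\<close>]
    show "(CLINT \<omega>|M. iexp (\<Sum>i\<in>I. a i * X i \<omega>)) = exp (- (\<Sum>i\<in>I. \<Sum>j\<in>I. a i * a j * covariance M (X i) (X j)) / 2)"
      by (simp only: S_def)
  qed (use int cov in \<open>auto simp: mult.commute\<close>)
qed

text \<open>By maximality every element of \<open>A\<close> is related to an element of a maximal set without related pairs, so
  the neighbourhoods of this set cover \<open>A\<close>.\<close>
lemma large_sparse_subset:
  fixes A :: "'i set" and n :: real
  assumes "finite A" and refl: "\<And>i. i \<in> A \<Longrightarrow> E i i"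
    and deg: "\<And>i. i \<in> A \<Longrightarrow> real (card {k \<in> A. E k i}) \<le> n"
    and sym: "\<And>i j. E i j \<Longrightarrow> E j i"
  obtains J where "J \<subseteq> A" "\<And>i j. i \<in> J \<Longrightarrow> j \<in> J \<Longrightarrow> i \<noteq> j \<Longrightarrow> \<not> E i j" "real (card A) \<le> real (card J) * n"
proof -
  define indep where "indep = (\<lambda>J. J \<subseteq> A \<and> (\<forall>i\<in>J. \<forall>j\<in>J. i \<noteq> j \<longrightarrow> \<not> E i j))"
  have "finite {J. indep J}"
    using \<open>finite A\<close> by (rule_tac finite_subset[of _ "Pow A"]) (auto simp: indep_def)
  moreover have "indep {}" by (simp add: indep_def)
  ultimately obtain J where J: "indep J" and max: "\<And>K. indep K \<Longrightarrow> J \<subseteq> K \<Longrightarrow> K = J"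
    using finite_has_maximal[of "{J. indep J}"] by blast
  have "J \<subseteq> A" using J by (simp add: indep_def)
  then have "finite J" using \<open>finite A\<close> finite_subset by blast
  have "A \<subseteq> (\<Union>j\<in>J. {k \<in> A. E k j})"
  proof
    fix k assume k: "k \<in> A"
    show "k \<in> (\<Union>j\<in>J. {k \<in> A. E k j})"
    proof (rule ccontr)
      assume no: "k \<notin> (\<Union>j\<in>J. {k \<in> A. E k j})"
      then have "k \<notin> J" using refl k by auto
      have "indep (insert k J)" using J k no sym by (auto simp: indep_def)
      then have "insert k J = J" using max by blast
      then show False using \<open>k \<notin> J\<close> by blast
    qed
  qed
  then have "card A \<le> card (\<Union>j\<in>J. {k \<in> A. E k j})"
    using \<open>finite A\<close> \<open>finite J\<close> by (intro card_mono) auto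
  also have "\<dots> \<le> (\<Sum>j\<in>J. card {k \<in> A. E k j})"
    using \<open>finite J\<close> by (rule card_UN_le)
  finally have "real (card A) \<le> (\<Sum>j\<in>J. real (card {k \<in> A. E k j}))"
    by (metis of_nat_le_iff of_nat_sum)
  also have "\<dots> \<le> (\<Sum>j\<in>J. n)"
    using deg \<open>J \<subseteq> A\<close> by (intro sum_mono) auto
  finally show ?thesis using that[of J] J by (auto simp: indep_def)
qed

section \<open>The standard normal tail and its quantiles\<close>

definition normal_tail :: "real \<Rightarrow> real" where
  "normal_tail x = 1 - std_normal_cdf x"

lemma normal_tail_eq_measure: "normal_tail x = measure std_normal_distribution {x<..}"
proof -
  interpret real_distribution std_normal_distribution by (rule real_dist_normal_dist)
  have "{x<..} = space std_normal_distribution - {..x}" by auto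
  then show ?thesis
    using prob_compl[of "{..x}"] by (simp add: normal_tail_def std_normal_cdf_def cdf_def)
qed

lemma normal_tail_nonneg: "0 \<le> normal_tail x"
  by (simp add: normal_tail_eq_measure)

lemma normal_tail_antimono: "x \<le> y \<Longrightarrow> normal_tail y \<le> normal_tail x"
proof -
  interpret real_distribution std_normal_distribution by (rule real_dist_normal_dist)
  show "x \<le> y \<Longrightarrow> normal_tail y \<le> normal_tail x"
    by (simp add: normal_tail_def std_normal_cdf_def cdf_nondecreasing)
qed

lemma ennreal_normal_tail:
  "ennreal (normal_tail x) = (\<integral>\<^sup>+t. ennreal (std_normal_density t) * indicator {x<..} t \<partial>lborel)"
proof -
  interpret real_distribution std_normal_distribution by (rule real_dist_normal_dist)
  show ?thesis
    unfolding normal_tail_eq_measure emeasure_eq_measure[symmetric] by (simp add: emeasure_density)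
qed

text \<open>The density satisfies \<open>\<phi> (t + h) = \<phi> t exp (- t h - h\<^sup>2 / 2)\<close>, which for \<open>t > x\<close> is at most
  \<open>exp (- x h) \<phi> t\<close>. As an upper bound this compares \<open>Q ((1 + \<delta>) u)\<close> with \<open>Q u\<close>; read backwards, it
  bounds \<open>Q ((1 - \<delta> / 2) u)\<close> from below.\<close>
lemma normal_tail_shift_le:
  assumes "0 \<le> h"
  shows "normal_tail (x + h) \<le> exp (- x * h) * normal_tail x"
proof -
  have "ennreal (normal_tail (x + h)) = (\<integral>\<^sup>+t. ennreal (std_normal_density (h + t)) * indicator {x + h<..} (h + t) \<partial>lborel)"
    unfolding ennreal_normal_tail by (subst nn_integral_real_affine[where c = 1 and t = h]) auto
  also have "\<dots> \<le> (\<integral>\<^sup>+t. ennreal (exp (- x * h)) * (ennreal (std_normal_density t) * indicator {x<..} t) \<partial>lborel)"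
  proof (rule nn_integral_mono)
    fix t :: real
    have "std_normal_density (h + t) \<le> exp (- x * h) * std_normal_density t" if "x < t"
    proof -
      have "x * h \<le> t * h" using that \<open>0 \<le> h\<close> by (intro mult_right_mono) auto
      moreover have "0 \<le> h\<^sup>2" by simp
      moreover have "(h + t)\<^sup>2 = h\<^sup>2 + t\<^sup>2 + 2 * (t * h)" by (simp add: power2_sum)
      ultimately have "- (h + t)\<^sup>2 / 2 \<le> - x * h + - t\<^sup>2 / 2"
        by linarith
      then have "exp (- (h + t)\<^sup>2 / 2) \<le> exp (- x * h) * exp (- t\<^sup>2 / 2)"
        unfolding exp_add[symmetric] exp_le_cancel_iff .
      then show ?thesis by (simp add: std_normal_density_def divide_right_mono)
    qed
    then show "ennreal (std_normal_density (h + t)) * indicator {x + h<..} (h + t)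
        \<le> ennreal (exp (- x * h)) * (ennreal (std_normal_density t) * indicator {x<..} t)"
      by (auto simp: indicator_def ennreal_mult[symmetric] intro!: ennreal_leI)
  qed
  also have "\<dots> = ennreal (exp (- x * h) * normal_tail x)"
    by (simp add: nn_integral_cmult ennreal_normal_tail ennreal_mult normal_tail_nonneg)
  finally show ?thesis by (simp add: ennreal_le_iff normal_tail_nonneg)
qed

lemma normal_tail_ge_density:
  assumes "0 \<le> x"
  shows "std_normal_density (x + 1) \<le> normal_tail x"
proof -
  have "ennreal (std_normal_density (x + 1)) = (\<integral>\<^sup>+t. ennreal (std_normal_density (x + 1)) * indicator {x<..x + 1} t \<partial>lborel)"
    by (subst nn_integral_cmult_indicator) auto
  also have "\<dots> \<le> ennreal (normal_tail x)"
    unfolding ennreal_normal_tail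
  proof (rule nn_integral_mono)
    fix t :: real
    have "std_normal_density (x + 1) \<le> std_normal_density t" if "x < t" "t \<le> x + 1"
      using that assms by (simp add: std_normal_density_def divide_right_mono)
    then show "ennreal (std_normal_density (x + 1)) * indicator {x<..x + 1} t \<le> ennreal (std_normal_density t) * indicator {x<..} t"
      by (auto simp: indicator_def intro!: ennreal_leI)
  qed
  finally show ?thesis by (simp add: ennreal_le_iff normal_tail_nonneg)
qed

lemma normal_tail_pos: "0 < normal_tail x"
proof -
  have "0 < std_normal_density (max x 0 + 1)" by (simp add: normal_density_pos)
  also have "\<dots> \<le> normal_tail (max x 0)" by (intro normal_tail_ge_density) auto
  also have "\<dots> \<le> normal_tail x" by (intro normal_tail_antimono) auto
  finally show ?thesis .
qed

lemma std_normal_cdf_lim_neg: "(std_normal_cdf \<longlongrightarrow> 0) at_bot"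
proof -
  interpret real_distribution std_normal_distribution by (rule real_dist_normal_dist)
  show ?thesis unfolding std_normal_cdf_def by (rule cdf_lim_at_bot)
qed

lemma std_normal_cdf_mono: "x \<le> y \<Longrightarrow> std_normal_cdf x \<le> std_normal_cdf y"
  using normal_tail_antimono[of x y] by (simp add: normal_tail_def)

lemma normal_tail_quantile:
  assumes "2 \<le> p"
  shows "normal_tail (normal_quantile p) = 1 / real p"
proof -
  interpret real_distribution std_normal_distribution by (rule real_dist_normal_dist)
  have "measure std_normal_distribution {x} = 0" for x
    by (simp add: measure_def emeasure_density nn_integral_indicator_singleton')
  then have cont: "isCont std_normal_cdf x" for x
    by (simp add: std_normal_cdf_def isCont_cdf)
  define y where "y = 1 - 1 / real p"
  have y: "0 < y" "y < 1" using assms by (auto simp: y_def)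
  have "\<forall>\<^sub>F x in at_bot. std_normal_cdf x < y"
    using std_normal_cdf_lim_neg y(1) by (rule order_tendstoD)
  then obtain a where a: "std_normal_cdf a < y" by (auto dest: eventually_happens)
  have "\<forall>\<^sub>F x in at_top. y < std_normal_cdf x"
    using cdf_lim_at_top_prob y(2) unfolding std_normal_cdf_def by (rule order_tendstoD)
  then obtain b where b: "y < std_normal_cdf b" by (auto dest: eventually_happens)
  have "a \<le> b" using a b std_normal_cdf_mono[of b a] by linarith
  then obtain x where "std_normal_cdf x = y"
    using IVT'[of std_normal_cdf a y b] a b cont by (auto simp: continuous_at_imp_continuous_on)
  then have "std_normal_cdf (inv std_normal_cdf y) = y" by (intro f_inv_into_f) auto
  then show ?thesis by (simp add: normal_tail_def normal_quantile_def y_def)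
qed

text \<open>Only the growth rate of \<open>u\<close> matters, so the crude bound \<open>Q u \<ge> \<phi> (u + 1)\<close> and a constant worse
  than the sharp one are enough.\<close>
lemma normal_quantile_lower:
  "\<forall>\<^sub>F p in sequentially. 0 < normal_quantile p \<and> ln (real p) / 4 \<le> (normal_quantile p)\<^sup>2"
proof -
  have "\<forall>\<^sub>F p in sequentially. 1 / real p < normal_tail 2"
    by (rule order_tendstoD(2)[OF lim_1_over_n normal_tail_pos])
  then show ?thesis using eventually_ge_at_top[of 2]
  proof eventually_elim
    case (elim p)
    define u where "u = normal_quantile p"
    have Qu: "normal_tail u = 1 / real p" using elim by (simp add: u_def normal_tail_quantile)
    have u: "2 < u" using elim normal_tail_antimono[of u 2] Qu by linarith
    have "2 * pi \<le> 3\<^sup>2" using pi_less_4 by simp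
    then have sqrt: "sqrt (2 * pi) \<le> 3" by (intro real_le_lsqrt) auto
    have "std_normal_density (u + 1) \<le> 1 / real p"
      using normal_tail_ge_density[of u] u Qu by simp
    then have "real p \<le> sqrt (2 * pi) * exp ((u + 1)\<^sup>2 / 2)"
      using elim by (simp add: std_normal_density_def exp_minus field_simps)
    then have "ln (real p) \<le> ln (sqrt (2 * pi) * exp ((u + 1)\<^sup>2 / 2))"
      using elim by (subst ln_le_cancel_iff) auto
    also have "\<dots> = ln (sqrt (2 * pi)) + (u + 1)\<^sup>2 / 2"
      by (subst ln_mult) auto
    also have "ln (sqrt (2 * pi)) \<le> 2"
      using ln_le_minus_one[of "sqrt (2 * pi)"] sqrt by simp
    also have "2 + (u + 1)\<^sup>2 / 2 \<le> 4 * u\<^sup>2"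
    proof -
      have "2 * u \<le> u * u" using u by (intro mult_right_mono) auto
      moreover have "(u + 1)\<^sup>2 = u * u + 2 * u + 1" "u\<^sup>2 = u * u"
        by (simp_all add: power2_eq_square algebra_simps)
      ultimately show ?thesis using u by linarith
    qed
    finally show ?case using u by (simp add: u_def)
  qed
qed

section \<open>Relative stability of the row maxima\<close>

lemma prob_row_max_gt_le:
  assumes "prob_space M" and arr: "gaussian_array M \<epsilon>" and "1 \<le> p"
  shows "measure M {\<omega> \<in> space M. row_max \<epsilon> p \<omega> > x} \<le> real p * normal_tail x"
proof -
  interpret prob_space M by fact
  have \<epsilon>m: "\<epsilon> p i \<in> borel_measurable M" and law: "distr M borel (\<epsilon> p i) = std_normal_distribution"
    if "i \<in> {1..p}" for i
    using arr that \<open>1 \<le> p\<close> by (auto simp: gaussian_array_def jointly_gaussian_def)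
  have ne: "finite ((\<lambda>i. \<epsilon> p i \<omega>) ` {1..p})" "(\<lambda>i. \<epsilon> p i \<omega>) ` {1..p} \<noteq> {}" for \<omega>
    using \<open>1 \<le> p\<close> by auto
  have "{\<omega> \<in> space M. row_max \<epsilon> p \<omega> > x} = (\<Union>i\<in>{1..p}. {\<omega> \<in> space M. \<epsilon> p i \<omega> > x})"
    unfolding row_max_def Max_gr_iff[OF ne] by auto
  also have "measure M \<dots> \<le> (\<Sum>i\<in>{1..p}. measure M {\<omega> \<in> space M. \<epsilon> p i \<omega> > x})"
    using \<epsilon>m by (intro finite_measure_subadditive_finite) auto
  also have "\<dots> = (\<Sum>i\<in>{1..p}. normal_tail x)"
  proof (rule sum.cong[OF refl])
    fix i assume i: "i \<in> {1..p}"
    have "{\<omega> \<in> space M. \<epsilon> p i \<omega> > x} = \<epsilon> p i -` {x<..} \<inter> space M" by auto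
    then show "measure M {\<omega> \<in> space M. \<epsilon> p i \<omega> > x} = normal_tail x"
      unfolding normal_tail_eq_measure law[OF i, symmetric] using measure_distr[OF \<epsilon>m[OF i], of "{x<..}"] by simp
  qed
  finally show ?thesis by simp
qed

text \<open>Slepian's inequality on a sparse set \<open>J\<close> of indices, where \<open>card J \<ge> p / N t\<close>, followed by
  \<open>(1 - Q) ^ card J \<le> exp (- card J * Q)\<close>.\<close>
lemma prob_row_max_le_le:
  assumes "prob_space M" and arr: "gaussian_array M \<epsilon>" and udd: "UDD_bound M \<epsilon> N"
    and "1 \<le> p" and t: "0 < t" "t < 1"
  shows "1 \<le> N t"
    and "measure M {\<omega> \<in> space M. row_max \<epsilon> p \<omega> \<le> x}
      \<le> std_normal_cdf (- s) + exp (- (real p / N t * normal_tail ((x + sqrt t * s) / sqrt (1 - t))))"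
proof -
  interpret prob_space M by fact
  let ?R = "\<lambda>i j. covariance M (\<epsilon> p i) (\<epsilon> p j)"
  define y where "y = (x + sqrt t * s) / sqrt (1 - t)"
  have gv: "gaussian_vector M {1..p} (\<epsilon> p) ?R" and diag: "\<And>i. i \<in> {1..p} \<Longrightarrow> ?R i i = 1"
    using jointly_gaussian_imp_gaussian_vector[OF \<open>prob_space M\<close>, of "{1..p}" "\<epsilon> p"] arr \<open>1 \<le> p\<close>
    by (auto simp: gaussian_array_def)
  have \<epsilon>m: "\<epsilon> p i \<in> borel_measurable M" if "i \<in> {1..p}" for i
    using arr that \<open>1 \<le> p\<close> by (auto simp: gaussian_array_def jointly_gaussian_def)
  have deg: "real (card {k \<in> {1..p}. ?R k i > t}) \<le> N t" if "i \<in> {1..p}" for i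
    using udd t \<open>1 \<le> p\<close> that unfolding UDD_bound_def by blast
  have "0 < card {k \<in> {1..p}. ?R k 1 > t}"
    using diag[of 1] t \<open>1 \<le> p\<close> by (auto simp: card_gt_0_iff intro!: exI[of _ 1])
  then show N1: "1 \<le> N t" using deg[of 1] \<open>1 \<le> p\<close> by auto
  have sym: "?R i j = ?R j i" for i j by (simp add: covariance_def mult.commute)
  obtain J where J: "J \<subseteq> {1..p}" and indep: "\<And>i j. i \<in> J \<Longrightarrow> j \<in> J \<Longrightarrow> i \<noteq> j \<Longrightarrow> \<not> ?R i j > t"
    and card: "real (card {1..p}) \<le> real (card J) * N t"
  proof (rule large_sparse_subset[of "{1..p}" "\<lambda>i j. ?R i j > t" "N t"])
    show "?R i i > t" if "i \<in> {1..p}" for i using diag[OF that] t by simp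
    show "?R j i > t" if "?R i j > t" for i j using that sym[of i j] by simp
  qed (use deg in auto)
  have "finite J" using J finite_subset by blast
  interpret N: prob_space std_normal_distribution by (rule prob_space_std_normal)
  interpret J: prob_space "iid_normal J" by (intro prob_space_PiM prob_space_std_normal)
  interpret NJ: pair_prob_space std_normal_distribution "iid_normal J" ..
  have "measure M {\<omega> \<in> space M. row_max \<epsilon> p \<omega> \<le> x} \<le> measure M {\<omega> \<in> space M. \<forall>i\<in>J. \<epsilon> p i \<omega> \<le> x}"
  proof (rule finite_measure_mono)
    show "{\<omega> \<in> space M. row_max \<epsilon> p \<omega> \<le> x} \<subseteq> {\<omega> \<in> space M. \<forall>i\<in>J. \<epsilon> p i \<omega> \<le> x}"
      using J by (auto simp: row_max_def intro: order_trans[OF Max_ge])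
    have [measurable]: "\<And>i. i \<in> J \<Longrightarrow> \<epsilon> p i \<in> borel_measurable M" using \<epsilon>m J by auto
    show "{\<omega> \<in> space M. \<forall>i\<in>J. \<epsilon> p i \<omega> \<le> x} \<in> sets M" using \<open>finite J\<close> by measurable
  qed
  also have "\<dots> \<le> measure (std_normal_distribution \<Otimes>\<^sub>M iid_normal J)
      {\<omega> \<in> space (std_normal_distribution \<Otimes>\<^sub>M iid_normal J). \<forall>i\<in>J. sqrt (1 - t) * snd \<omega> i + sqrt t * fst \<omega> \<le> x}"
  proof (rule slepian_inequality[OF \<open>prob_space M\<close> NJ.prob_space_axioms \<open>finite J\<close>
        gaussian_vector_subset[OF gv _ J] gaussian_vector_equicorrelated[OF \<open>finite J\<close>]])
    show "?R i i = 1" if "i \<in> J" for i using diag that J by auto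
    show "?R i j \<le> (if i = j then 1 else t)" if "i \<in> J" "j \<in> J" for i j
      using indep[OF that] diag[of i] that J by (auto simp: not_less)
  qed (use t in auto)
  also have "\<dots> \<le> std_normal_cdf (- s) + std_normal_cdf y ^ card J"
    unfolding y_def by (rule prob_equicorrelated_le[OF \<open>finite J\<close> t])
  also have "std_normal_cdf y ^ card J \<le> exp (- normal_tail y) ^ card J"
  proof (rule power_mono)
    show "std_normal_cdf y \<le> exp (- normal_tail y)"
      using exp_ge_add_one_self[of "- normal_tail y"] by (simp add: normal_tail_def)
    show "0 \<le> std_normal_cdf y" by (simp add: std_normal_cdf_def cdf_def)
  qed
  also have "\<dots> = exp (- (real (card J) * normal_tail y))"
    by (simp add: exp_of_nat_mult[symmetric])
  also have "\<dots> \<le> exp (- (real p / N t * normal_tail y))"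
  proof -
    have "real p / N t \<le> real (card J)" using card N1 by (simp add: field_simps)
    then have "real p / N t * normal_tail y \<le> real (card J) * normal_tail y"
      by (rule mult_right_mono) (rule normal_tail_nonneg)
    then show ?thesis by (simp only: exp_le_cancel_iff neg_le_iff_le)
  qed
  finally show "measure M {\<omega> \<in> space M. row_max \<epsilon> p \<omega> \<le> x}
      \<le> std_normal_cdf (- s) + exp (- (real p / N t * normal_tail ((x + sqrt t * s) / sqrt (1 - t))))"
    by (simp add: y_def)
qed

text \<open>A bound for each single row in terms of \<open>d * ln p\<close> alone. The slack \<open>d u\<close> below the quantile is
  divided as follows: \<open>d u / 4\<close> compensates the common component down to \<open>- s\<close>, another \<open>d u / 4\<close>
  the factor \<open>sqrt (1 - t)\<close>, and the remaining \<open>d u / 2\<close> raises \<open>p Q\<close> enough to pay for \<open>N t\<close>.\<close>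
lemma prob_row_max_deviation_le:
  assumes "prob_space M" and "gaussian_array M \<epsilon>" and "UDD_bound M \<epsilon> N"
    and "2 \<le> p" and t: "0 < t" "t \<le> d / 32" and d: "d < 1"
    and N: "ln (N t) \<le> d / 32 * ln (real p)"
    and u: "0 < normal_quantile p" "ln (real p) / 4 \<le> (normal_quantile p)\<^sup>2"
  shows "measure M {\<omega> \<in> space M. \<bar>row_max \<epsilon> p \<omega> / normal_quantile p - 1\<bar> > d}
    \<le> exp (- (d * ln (real p) / 4)) + std_normal_cdf (- (sqrt (d * ln (real p)) / 4))
      + exp (- exp (d * ln (real p) / 32))"
proof -
  interpret prob_space M by fact
  define u where "u = normal_quantile p"
  define L where "L = ln (real p)"
  define s where "s = d * u / (4 * sqrt t)"
  define y where "y = ((1 - d) * u + sqrt t * s) / sqrt (1 - t)"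
  have "0 < d" "t < 1" using t d by linarith+
  have "0 < L" using \<open>2 \<le> p\<close> by (simp add: L_def)
  have u: "0 < u" "L / 4 \<le> u\<^sup>2" using u by (simp_all add: u_def L_def)
  have tail_u: "normal_tail u = 1 / real p" using \<open>2 \<le> p\<close> by (simp add: u_def normal_tail_quantile)
  have "1 \<le> p" using \<open>2 \<le> p\<close> by simp
  note upper = prob_row_max_gt_le[OF assms(1,2) \<open>1 \<le> p\<close>, of "(1 + d) * u"]
  note lower = prob_row_max_le_le[OF assms(1-3) \<open>1 \<le> p\<close> t(1) \<open>t < 1\<close>]
  have dL: "d * L / 4 \<le> d * u\<^sup>2" using mult_left_mono[OF u(2), of d] \<open>0 < d\<close> by simp

  \<comment> \<open>The maximum is too large: union bound.\<close>
  have "real p * normal_tail ((1 + d) * u) \<le> real p * (exp (- u * (d * u)) * normal_tail u)"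
    using normal_tail_shift_le[of "d * u" u] \<open>0 < d\<close> u by (intro mult_left_mono) (auto simp: algebra_simps)
  also have "\<dots> = exp (- (d * u\<^sup>2))" using tail_u \<open>2 \<le> p\<close> by (simp add: power2_eq_square mult_ac)
  also have "\<dots> \<le> exp (- (d * L / 4))" using dL by simp
  finally have upper_bound: "measure M {\<omega> \<in> space M. row_max \<epsilon> p \<omega> > (1 + d) * u} \<le> exp (- (d * L / 4))"
    using upper by linarith

  \<comment> \<open>The maximum is too small: the level \<open>y\<close> for the independent components is still well below \<open>u\<close>.\<close>
  have "y \<le> (1 - d / 2) * u"
  proof -
    have "1 - t \<le> sqrt (1 - t)"
      using t \<open>t < 1\<close> by (intro real_le_rsqrt) (simp add: power2_eq_square mult_left_le)
    then have "(1 - d / 2) * (1 - t) \<le> (1 - d / 2) * sqrt (1 - t)"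
      using d by (intro mult_left_mono) auto
    moreover have "1 - 3 * d / 4 \<le> (1 - d / 2) * (1 - t)"
    proof -
      have "(1 - d / 2) * (1 - t) = 1 - d / 2 - t + d * t / 2" by (simp add: field_simps)
      moreover have "0 \<le> d * t" using t \<open>0 < d\<close> by simp
      ultimately show ?thesis using t by linarith
    qed
    ultimately have "(1 - 3 * d / 4) * u \<le> (1 - d / 2) * sqrt (1 - t) * u"
      using u by (intro mult_right_mono) auto
    moreover have "(1 - d) * u + sqrt t * s = (1 - 3 * d / 4) * u"
      using t by (simp add: s_def field_simps)
    ultimately show ?thesis
      using \<open>t < 1\<close> by (simp add: y_def divide_le_eq mult_ac)
  qed
  then have "normal_tail ((1 - d / 2) * u) \<le> normal_tail y" by (rule normal_tail_antimono)
  moreover have "normal_tail u \<le> exp (- ((1 - d / 2) * u) * (d * u / 2)) * normal_tail ((1 - d / 2) * u)"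
    using normal_tail_shift_le[of "d * u / 2" "(1 - d / 2) * u"] \<open>0 < d\<close> u by (simp add: algebra_simps)
  ultimately have "1 / real p \<le> exp (- ((1 - d / 2) * u) * (d * u / 2)) * normal_tail y"
    unfolding tail_u by (meson exp_ge_zero mult_left_mono order_trans)
  then have "exp ((1 - d / 2) * u * (d * u / 2)) \<le> real p * normal_tail y"
    using \<open>2 \<le> p\<close> by (simp add: exp_minus field_simps)
  moreover have "d * L / 16 \<le> (1 - d / 2) * u * (d * u / 2)"
  proof -
    have "1 / 2 * (d * u\<^sup>2 / 2) \<le> (1 - d / 2) * (d * u\<^sup>2 / 2)"
      using d \<open>0 < d\<close> by (intro mult_right_mono) auto
    moreover have "(1 - d / 2) * u * (d * u / 2) = (1 - d / 2) * (d * u\<^sup>2 / 2)"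
      by (simp add: power2_eq_square)
    ultimately show ?thesis using dL by linarith
  qed
  ultimately have tail_y: "exp (d * L / 16) \<le> real p * normal_tail y"
    by (meson exp_le_cancel_iff order_trans)
  have "exp (d * L / 32) \<le> exp (d * L / 16 - ln (N t))"
    using N by (simp add: L_def)
  also have "\<dots> = exp (d * L / 16) / N t"
    using lower(1) by (simp add: exp_diff)
  also have "\<dots> \<le> real p / N t * normal_tail y"
    using tail_y lower(1) by (simp add: divide_right_mono)
  finally have Jbound: "exp (d * L / 32) \<le> real p / N t * normal_tail y" .

  \<comment> \<open>The common component is unlikely to fall below \<open>- s\<close>.\<close>
  have "sqrt (d * L) / 4 \<le> s"
  proof -
    have "sqrt (d * L) * sqrt t = sqrt ((d * L) * t)" by (simp add: real_sqrt_mult)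
    also have "\<dots> \<le> sqrt ((d * u)\<^sup>2)"
    proof (rule real_sqrt_le_mono)
      have "(d * L) * t \<le> (d * L) * (d / 4)"
        using t \<open>0 < d\<close> \<open>0 < L\<close> by (intro mult_left_mono) auto
      also have "\<dots> \<le> (d * u)\<^sup>2"
        using mult_left_mono[OF dL, of d] \<open>0 < d\<close> by (simp add: power2_eq_square mult_ac)
      finally show "(d * L) * t \<le> (d * u)\<^sup>2" .
    qed
    also have "\<dots> = d * u" using \<open>0 < d\<close> u by simp
    finally show ?thesis using t by (simp add: s_def field_simps)
  qed
  then have sbound: "std_normal_cdf (- s) \<le> std_normal_cdf (- (sqrt (d * L) / 4))"
    by (intro std_normal_cdf_mono) simp
  have lower_bound: "measure M {\<omega> \<in> space M. row_max \<epsilon> p \<omega> \<le> (1 - d) * u}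
      \<le> std_normal_cdf (- (sqrt (d * L) / 4)) + exp (- exp (d * L / 32))"
  proof -
    have "exp (- (real p / N t * normal_tail y)) \<le> exp (- exp (d * L / 32))" using Jbound by simp
    then show ?thesis using lower(2)[of "(1 - d) * u" s] sbound unfolding y_def[symmetric] by linarith
  qed

  have \<epsilon>m: "\<epsilon> p i \<in> borel_measurable M" if "i \<in> {1..p}" for i
    using assms(2) that \<open>1 \<le> p\<close> by (auto simp: gaussian_array_def jointly_gaussian_def)
  then have [measurable]: "row_max \<epsilon> p \<in> borel_measurable M"
    unfolding row_max_def by (intro borel_measurable_Max) auto
  have "{\<omega> \<in> space M. \<bar>row_max \<epsilon> p \<omega> / u - 1\<bar> > d}
      \<subseteq> {\<omega> \<in> space M. row_max \<epsilon> p \<omega> > (1 + d) * u} \<union> {\<omega> \<in> space M. row_max \<epsilon> p \<omega> \<le> (1 - d) * u}"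
    using u by (auto simp: abs_if field_simps split: if_splits)
  then have "measure M {\<omega> \<in> space M. \<bar>row_max \<epsilon> p \<omega> / u - 1\<bar> > d}
      \<le> measure M ({\<omega> \<in> space M. row_max \<epsilon> p \<omega> > (1 + d) * u} \<union> {\<omega> \<in> space M. row_max \<epsilon> p \<omega> \<le> (1 - d) * u})"
    by (rule finite_measure_mono) measurable
  also have "\<dots> \<le> measure M {\<omega> \<in> space M. row_max \<epsilon> p \<omega> > (1 + d) * u} + measure M {\<omega> \<in> space M. row_max \<epsilon> p \<omega> \<le> (1 - d) * u}"
    by (rule measure_Un_le) measurable
  finally show ?thesis using upper_bound lower_bound by (simp add: u_def L_def)
qed

theorem theorem4p1:
  fixes M :: "'a measure"
    and \<epsilon> :: "nat \<Rightarrow> nat \<Rightarrow> 'a \<Rightarrow> real"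
    and N :: "real \<Rightarrow> real"
    and \<tau> \<alpha> \<delta> :: "nat \<Rightarrow> real"
  assumes "prob_space M"
    and "gaussian_array M \<epsilon>"
    and "UDD M \<epsilon>"
    and "UDD_bound M \<epsilon> N"
    and "\<forall>p\<ge>1. \<tau> p > 0"
    and "\<tau> \<longlonglongrightarrow> 0"
    and "\<forall>p. \<alpha> p = ln (N (\<tau> p)) / ln (real p)"
    and "\<alpha> \<longlonglongrightarrow> 0"
    and "\<forall>p\<ge>1. \<delta> p > 0"
    and "\<delta> \<ggreater> (\<lambda>p. \<alpha> p + \<tau> p + 1 / ln (real p))"
  shows "(\<lambda>p. measure M {\<omega> \<in> space M. \<bar>row_max \<epsilon> p \<omega> / normal_quantile p - 1\<bar> > \<delta> p})
           \<longlonglongrightarrow> 0"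
proof -
  define \<beta> where "\<beta> = (\<lambda>p. \<alpha> p + \<tau> p + 1 / ln (real p))"
  define r where "r = (\<lambda>p. \<delta> p * ln (real p))"
  have ratio: "(\<lambda>p. \<beta> p / \<delta> p) \<longlonglongrightarrow> 0" and "\<delta> \<longlonglongrightarrow> 0"
    using assms(10) by (auto simp: much_greater_def \<beta>_def)
  \<comment> \<open>Without \<open>\<alpha> \<ge> 0\<close> the sum could be small by cancellation. Once \<open>\<tau> p < 1\<close>, each variable
    is correlated with itself above the level \<open>\<tau> p\<close>, hence \<open>N (\<tau> p) \<ge> 1\<close>.\<close>
  have \<alpha>_nonneg: "\<forall>\<^sub>F p in sequentially. 0 \<le> \<alpha> p"
    using order_tendstoD(2)[OF assms(6), of 1, simplified] eventually_ge_at_top[of 2]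
  proof eventually_elim
    case (elim p)
    then have "1 \<le> N (\<tau> p)"
      using prob_row_max_le_le(1)[OF assms(1,2,4), of p "\<tau> p"] assms(5) by auto
    then show ?case using elim assms(7) by simp
  qed
  have small: "\<forall>\<^sub>F p in sequentially. \<alpha> p \<le> \<delta> p / 32 \<and> \<tau> p \<le> \<delta> p / 32"
    using \<alpha>_nonneg order_tendstoD(2)[OF ratio, of "1/32", simplified] eventually_ge_at_top[of 2]
  proof eventually_elim
    case (elim p)
    then have "\<beta> p \<le> \<delta> p / 32" using assms(9) by (simp add: field_simps)
    moreover have "0 < \<tau> p" "0 < 1 / ln (real p)" using elim assms(5) by auto
    moreover have "\<beta> p = \<alpha> p + \<tau> p + 1 / ln (real p)" by (simp add: \<beta>_def)
    ultimately show ?case using elim by linarith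
  qed
  have r_top: "filterlim r at_top sequentially"
  proof -
    have "(\<lambda>p. inverse (r p)) \<longlonglongrightarrow> 0"
    proof (rule tendsto_sandwich[OF _ _ tendsto_const ratio])
      show "\<forall>\<^sub>F p in sequentially. 0 \<le> inverse (r p)"
        using eventually_ge_at_top[of 2] by eventually_elim (use assms(9) in \<open>auto simp: r_def less_imp_le\<close>)
      show "\<forall>\<^sub>F p in sequentially. inverse (r p) \<le> \<beta> p / \<delta> p"
        using \<alpha>_nonneg eventually_ge_at_top[of 2]
      proof eventually_elim
        case (elim p)
        have "0 < \<delta> p" "0 < \<tau> p" using elim assms(5,9) by auto
        then have "1 / ln (real p) / \<delta> p \<le> \<beta> p / \<delta> p"
          using elim by (intro divide_right_mono) (auto simp: \<beta>_def)
        then show ?case by (simp add: r_def field_simps)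
      qed
    qed
    moreover have "\<forall>\<^sub>F p in sequentially. 0 < inverse (r p)"
      using eventually_ge_at_top[of 2] by eventually_elim (use assms(9) in \<open>auto simp: r_def\<close>)
    ultimately have "filterlim (\<lambda>p. inverse (inverse (r p))) at_top sequentially"
      by (rule filterlim_inverse_at_top)
    then show ?thesis by simp
  qed
  have bound: "\<forall>\<^sub>F p in sequentially. measure M {\<omega> \<in> space M. \<bar>row_max \<epsilon> p \<omega> / normal_quantile p - 1\<bar> > \<delta> p}
      \<le> exp (- (r p / 4)) + std_normal_cdf (- (sqrt (r p) / 4)) + exp (- exp (r p / 32))"
    using small normal_quantile_lower order_tendstoD(2)[OF \<open>\<delta> \<longlonglongrightarrow> 0\<close>, of 1, simplified] eventually_ge_at_top[of 2]
  proof eventually_elim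
    case (elim p)
    have "ln (N (\<tau> p)) = \<alpha> p * ln (real p)" using elim assms(7) by simp
    also have "\<dots> \<le> \<delta> p / 32 * ln (real p)" using elim by (intro mult_right_mono) auto
    finally show ?case
      using prob_row_max_deviation_le[OF assms(1,2,4), of p "\<tau> p" "\<delta> p"] elim assms(5) by (simp add: r_def)
  qed
  have "((\<lambda>r. exp (- (r / 4)) + std_normal_cdf (- (sqrt r / 4)) + exp (- exp (r / 32))) \<longlongrightarrow> 0 + 0 + 0) at_top"
  proof (intro tendsto_add)
    show "((\<lambda>r::real. exp (- (r / 4))) \<longlongrightarrow> 0) at_top" "((\<lambda>r::real. exp (- exp (r / 32))) \<longlongrightarrow> 0) at_top"
      by real_asymp+
    have "filterlim (\<lambda>r::real. - (sqrt r / 4)) at_bot at_top" by real_asymp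
    then show "((\<lambda>r. std_normal_cdf (- (sqrt r / 4))) \<longlongrightarrow> 0) at_top"
      by (rule filterlim_compose[OF std_normal_cdf_lim_neg])
  qed
  then have "(\<lambda>p. exp (- (r p / 4)) + std_normal_cdf (- (sqrt (r p) / 4)) + exp (- exp (r p / 32))) \<longlonglongrightarrow> 0"
    using filterlim_compose[OF _ r_top] by fastforce
  then show ?thesis
    by (rule tendsto_sandwich[OF _ bound tendsto_const, rotated]) simp
qed

end
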